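(* For any reflection expression $\underline t$, the image of the localization map $\mathbf{Loc}_{\underline t}$ is $\operatorname{im}\mathbf{Loc}_{\underline t}=\mathcal X(\underline t)$. In particular, $\mathcal X(\underline t)$ is a ring (a subring of $R^{\oplus\underline t}$).
   Context: Let $(W,S)$ be a Coxeter system and $T$ the set of its reflections ($W$-conjugates of elements of $S$). Let $\Bbbk$ be a field of characteristic different from $2$ and $V$ a finite-dimensional $\Bbbk$-vector space on which $W$ acts linearly and faithfully so that every $s\in S$ acts by a reflection $sv=v-\alpha_s^\vee(v)\alpha_s$ with $\alpha_s\in V$, $\alpha_s^\vee\in V^*$, $\alpha_s^\vee(\alpha_s)=2$. Then every $t\in T$ also acts by a reflection; fix $\alpha_t\in V$, $\alpha_t^\vee\in V^*$ with $\alpha_t^\vee(\alpha_t)=2$, $tv=v-\alpha_t^\vee(v)\alpha_t$. Assume the GKM-condition: if $\alpha_t$ and $\alpha_{t'}$ are proportional, then $t=t'$. $\operatorname{Sym}(V)$ is graded with $V$ in degree $2$; fix a $W$-invariant multiplicative subset $\boldsymbol\sigma$ of homogeneous elements containing no element divisible by a root $\alpha_t$, and put $R=\boldsymbol\sigma^{-1}\operatorname{Sym}(V)$. A reflection expression is a finite sequence $\underline t=(t_1,\ldots,t_n)$ in $T$; $\operatorname{Sub}(\underline t)$ is the set of its subexpressions, i.e. sequences $\underline\epsilon=(\epsilon_1,\ldots,\epsilon_n)\in\{0,1\}^n$. Put $\underline\epsilon^{<i}=t_1^{\epsilon_1}\cdots t_{i-1}^{\epsilon_{i-1}}$ for $1\le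 i\le n+1$, $\underline\epsilon^i=\underline\epsilon^{<i}t_i(\underline\epsilon^{<i})^{-1}\in T$ and $\mathcal M_p(\underline\epsilon)=\{i\mid\underline\epsilon^i=p\}$ for $p\in T$. For $Y\subset\{1,\ldots,n\}$, $\mathbf f_Y\underline\epsilon$ is obtained from $\underline\epsilon$ by replacing $\epsilon_i$ with $1-\epsilon_i$ for all $i\in Y$. $R(\underline t)=R\otimes_{R^{t_1}}R\otimes_{R^{t_2}}\cdots\otimes_{R^{t_n}}R$, where $R^t$ denotes $t$-invariants, is a ring under factorwise multiplication. $R^{\oplus\underline t}$ is the ring of all functions $\operatorname{Sub}(\underline t)\to R$ with pointwise operations. The map $\mathbf{Loc}_{\underline t}:R(\underline t)\to R^{\oplus\underline t}$ is the additive map given by $$\mathbf{Loc}_{\underline t}(a_1\otimes a_2\otimes\cdots\otimes a_{n+1})(\underline\epsilon)=(\underline\epsilon^{<1}a_1)(\underline\epsilon^{<2}a_2)\cdots(\underline\epsilon^{<n+1}a_{n+1}).$$ For a finite totally ordered set $X$ and $Y\subset X$, $|Y|_X$ is the number of elements of $Y$ at odd positions of $X$ counted decreasingly (the maximum of $X$ has position $1$). For $g:\operatorname{Sub}(\underline t)\to R$ and $X\subset\mathcal M_p(\underline\epsilon)$ put $\Sigma_X^{\underline\epsilon}(g)=\sum_{Y\subset X}(-1)^{|Y|_X}g(\mathbf f_Y\underline\epsilon)$. Then $\mathcal X(\underline t)$ is the set of all $g\in R^{\oplus\underline t}$ such that $\Sigma_X^{\underline\epsilon}(g)\in\alpha_p^{|X|}R$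 for all $p\in T$, $\underline\epsilon\in\operatorname{Sub}(\underline t)$ and $X\subset\mathcal M_p(\underline\epsilon)$. *)

theory Defs
  imports
    "HOL-Library.Poly_Mapping"
    "HOL-Computational_Algebra.Fraction_Field"
    "HOL-Algebra.Generated_Groups"
    "HOL-Algebra.Group_Action"
    "HOL-Algebra.Free_Abelian_Groups"
    "HOL-Algebra.Subrings"
begin

section \<open>Coxeter systems\<close>

text \<open>
  Equality of words in the group with generators \<open>S\<close> and relations \<open>(s t)\<^bsup>m s t\<^esup> = 1\<close>, where
  \<open>m s t = 0\<close> encodes \<open>\<infinity>\<close>, i.e. the absence of a relation.  As \<open>m s s = 1\<close> in a Coxeter matrix,
  generators are involutions and positive words suffice.
\<close>

inductive cox_cong :: "('s \<Rightarrow> 's \<Rightarrow> nat) \<Rightarrow> 's set \<Rightarrow> 's list \<Rightarrow> 's list \<Rightarrow> bool"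
  for m :: "'s \<Rightarrow> 's \<Rightarrow> nat" and S :: "'s set"
where
  rel: "\<lbrakk>s \<in> S; t \<in> S; m s t \<noteq> 0; u \<in> lists S; v \<in> lists S\<rbrakk>
          \<Longrightarrow> cox_cong m S (u @ concat (replicate (m s t) [s, t]) @ v) (u @ v)"
| refl: "u \<in> lists S \<Longrightarrow> cox_cong m S u u"
| sym: "cox_cong m S u v \<Longrightarrow> cox_cong m S v u"
| trans: "\<lbrakk>cox_cong m S u v; cox_cong m S v w\<rbrakk> \<Longrightarrow> cox_cong m S u w"

definition list_prod :: "('a, 'b) monoid_scheme \<Rightarrow> 'a list \<Rightarrow> 'a" where
  "list_prod G xs = foldr (\<lambda>x y. x \<otimes>\<^bsub>G\<^esub> y) xs \<one>\<^bsub>G\<^esub>"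

definition coxeter_matrix :: "'s set \<Rightarrow> ('s \<Rightarrow> 's \<Rightarrow> nat) \<Rightarrow> bool" where
  "coxeter_matrix S m \<longleftrightarrow> (\<forall>s\<in>S. \<forall>t\<in>S. m s t = m t s \<and> (m s t = 1 \<longleftrightarrow> s = t))"

definition coxeter_system :: "('w, 'b) monoid_scheme \<Rightarrow> 'w set \<Rightarrow> bool" where
  "coxeter_system W S \<longleftrightarrow>
     group W \<and> S \<subseteq> carrier W \<and> generate W S = carrier W \<and>
     (\<exists>m. coxeter_matrix S m \<and>
          (\<forall>u\<in>lists S. \<forall>v\<in>lists S. list_prod W u = list_prod W v \<longleftrightarrow> cox_cong m S u v))"

definition reflections :: "('w, 'b) monoid_scheme \<Rightarrow> 'w set \<Rightarrow> 'w set" where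
  "reflections W S = {w \<otimes>\<^bsub>W\<^esub> s \<otimes>\<^bsub>W\<^esub> inv\<^bsub>W\<^esub> w | w s. w \<in> carrier W \<and> s \<in> S}"


section \<open>The symmetric algebra\<close>

text \<open>
  A space with a basis \<open>e 0, \<dots>, e (n - 1)\<close> has as symmetric algebra the polynomials in the
  variables \<open>X\<^sub>0, \<dots>, X\<^bsub>n-1\<^esub>\<close>, the vector \<open>e i\<close> being identified with \<open>X\<^sub>i\<close>.  It is realised inside
  the polynomials in variables indexed by \<open>nat\<close>, as these form an integral domain by instantiation.
\<close>

type_synonym 'k mpoly = "(nat \<Rightarrow>\<^sub>0 nat) \<Rightarrow>\<^sub>0 'k"

definition mconst :: "'k::zero \<Rightarrow> 'k mpoly" where
  "mconst c = Poly_Mapping.single 0 c"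

definition mvar :: "nat \<Rightarrow> 'k::zero_neq_one mpoly" where
  "mvar i = Poly_Mapping.single (Poly_Mapping.single i 1) 1"

definition mono_eval :: "(nat \<Rightarrow> 'c) \<Rightarrow> (nat \<Rightarrow>\<^sub>0 nat) \<Rightarrow> 'c::comm_semiring_1" where
  "mono_eval f m = (\<Prod>i\<in>Poly_Mapping.keys m. f i ^ Poly_Mapping.lookup m i)"

definition mpoly_eval :: "('k::zero \<Rightarrow> 'c) \<Rightarrow> (nat \<Rightarrow> 'c) \<Rightarrow> 'k mpoly \<Rightarrow> 'c::comm_semiring_1" where
  "mpoly_eval h f p = (\<Sum>m\<in>Poly_Mapping.keys p. h (Poly_Mapping.lookup p m) * mono_eval f m)"

definition Sym :: "nat \<Rightarrow> 'k::zero mpoly set" where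
  "Sym n = {p. \<forall>m\<in>Poly_Mapping.keys p. Poly_Mapping.keys m \<subseteq> {..<n}}"

text \<open>Variables have degree \<open>2\<close>.\<close>

definition homogeneous :: "'k::zero mpoly \<Rightarrow> bool" where
  "homogeneous p \<longleftrightarrow> (\<exists>d. \<forall>m\<in>Poly_Mapping.keys p.
     2 * (\<Sum>i\<in>Poly_Mapping.keys m. Poly_Mapping.lookup m i) = d)"

definition basis_family ::
  "('k::field \<Rightarrow> 'v::ab_group_add \<Rightarrow> 'v) \<Rightarrow> nat \<Rightarrow> (nat \<Rightarrow> 'v) \<Rightarrow> bool" where
  "basis_family scale n e \<longleftrightarrow>
     inj_on e {..<n} \<and> finite_dimensional_vector_space scale (e ` {..<n})"

definition sym_incl ::
  "('k::field \<Rightarrow> 'v::ab_group_add \<Rightarrow> 'v) \<Rightarrow> nat \<Rightarrow> (nat \<Rightarrow> 'v) \<Rightarrow> 'v \<Rightarrow> 'k mpoly" where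
  "sym_incl scale n e v =
     (\<Sum>i<n. mconst (module.representation scale (e ` {..<n}) v (e i)) * mvar i)"

text \<open>
  The algebra endomorphism induced by a linear endomorphism \<open>f\<close> of the space.  The variables
  \<open>X\<^sub>i\<close> with \<open>n \<le> i\<close> do not occur in \<open>Sym n\<close>; they are fixed so that invertible maps induce
  automorphisms of the ambient polynomial ring.
\<close>

definition sym_map ::
  "('k::field \<Rightarrow> 'v::ab_group_add \<Rightarrow> 'v) \<Rightarrow> nat \<Rightarrow> (nat \<Rightarrow> 'v) \<Rightarrow> ('v \<Rightarrow> 'v) \<Rightarrow> 'k mpoly \<Rightarrow> 'k mpoly"
where
  "sym_map scale n e f =
     mpoly_eval mconst (\<lambda>i. if i < n then sym_incl scale n e (f (e i)) else mvar i)"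


section \<open>Localization\<close>

text \<open>
  The localization of a domain is formed inside its fraction field.  For \<open>0 \<in> \<sigma>\<close> this is not
  the zero ring, as \<open>Fract a 0 = 0\<close>; the case does not arise when \<open>\<sigma>\<close> contains no multiple of
  some root.
\<close>

definition localization :: "'a::idom set \<Rightarrow> 'a set \<Rightarrow> 'a fract set" where
  "localization A \<sigma> = {Fraction_Field.Fract a s | a s. a \<in> A \<and> s \<in> \<sigma>}"

text \<open>Well-defined for injective multiplicative \<open>f\<close>; see \<open>fract_map_Fract\<close> below.\<close>

definition fract_map :: "('a::idom \<Rightarrow> 'a) \<Rightarrow> 'a fract \<Rightarrow> 'a fract" where
  "fract_map f q = (THE r. \<exists>a b. b \<noteq> 0 \<and> q = Fraction_Field.Fract a b \<and> r = Fraction_Field.Fract (f a) (f b))"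


section \<open>Tensor products over subrings\<close>

definition tuples :: "'r set \<Rightarrow> nat \<Rightarrow> 'r list set" where
  "tuples R k = {xs. length xs = k \<and> set xs \<subseteq> R}"

text \<open>
  The tensor product of copies of \<open>R\<close> over a list of subrings is the free abelian group on tuples
  modulo multiadditivity and the balancing relations between neighbouring factors; the subgroup
  these generate is an ideal for the bilinear extension of the factorwise product.
\<close>

definition tuple_ring :: "'r::comm_ring_1 set \<Rightarrow> nat \<Rightarrow> ('r list \<Rightarrow>\<^sub>0 int) ring" where
  "tuple_ring R k =
     \<lparr>carrier = {c. Poly_Mapping.keys c \<subseteq> tuples R k},
      mult = (\<lambda>x y. frag_extend (\<lambda>xs. frag_extend (\<lambda>ys. frag_of (map2 (*) xs ys)) y) x),
      one = frag_of (replicate k 1),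
      zero = 0,
      add = (+)\<rparr>"

definition tensor_rels :: "'r::comm_ring_1 set \<Rightarrow> 'r set list \<Rightarrow> ('r list \<Rightarrow>\<^sub>0 int) set" where
  "tensor_rels R As =
     {frag_of (xs[i := a + b]) - frag_of (xs[i := a]) - frag_of (xs[i := b]) | xs i a b.
        xs \<in> tuples R (Suc (length As)) \<and> i < Suc (length As) \<and> a \<in> R \<and> b \<in> R} \<union>
     {frag_of (xs[i := xs ! i * r]) - frag_of (xs[Suc i := r * xs ! Suc i]) | xs i r.
        xs \<in> tuples R (Suc (length As)) \<and> i < length As \<and> r \<in> As ! i}"

definition tensor_ideal :: "'r::comm_ring_1 set \<Rightarrow> 'r set list \<Rightarrow> ('r list \<Rightarrow>\<^sub>0 int) set" where
  "tensor_ideal R As =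
     generate (add_monoid (tuple_ring R (Suc (length As)))) (tensor_rels R As)"

definition tensor_ring :: "'r::comm_ring_1 set \<Rightarrow> 'r set list \<Rightarrow> ('r list \<Rightarrow>\<^sub>0 int) set ring" where
  "tensor_ring R As = tuple_ring R (Suc (length As)) Quot tensor_ideal R As"

definition pure_tensor :: "'r::comm_ring_1 set \<Rightarrow> 'r set list \<Rightarrow> 'r list \<Rightarrow> ('r list \<Rightarrow>\<^sub>0 int) set" where
  "pure_tensor R As xs =
     tensor_ideal R As +>\<^bsub>tuple_ring R (Suc (length As))\<^esub> frag_of xs"


section \<open>Reflection expressions and localization maps\<close>

text \<open>Positions of expressions are counted from \<open>0\<close>; the entries \<open>0, 1\<close> of subexpressions are Booleans.\<close>

definition Sub :: "'w list \<Rightarrow> bool list set" where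
  "Sub t = {\<epsilon>. length \<epsilon> = length t}"

definition prefix_prod :: "('w, 'b) monoid_scheme \<Rightarrow> 'w list \<Rightarrow> bool list \<Rightarrow> nat \<Rightarrow> 'w" where
  "prefix_prod W t \<epsilon> i =
     list_prod W (map (\<lambda>j. if \<epsilon> ! j then t ! j else \<one>\<^bsub>W\<^esub>) [0..<i])"

definition sub_refl :: "('w, 'b) monoid_scheme \<Rightarrow> 'w list \<Rightarrow> bool list \<Rightarrow> nat \<Rightarrow> 'w" where
  "sub_refl W t \<epsilon> i =
     prefix_prod W t \<epsilon> i \<otimes>\<^bsub>W\<^esub> t ! i \<otimes>\<^bsub>W\<^esub> inv\<^bsub>W\<^esub> (prefix_prod W t \<epsilon> i)"

definition positions :: "('w, 'b) monoid_scheme \<Rightarrow> 'w list \<Rightarrow> bool list \<Rightarrow> 'w \<Rightarrow> nat set" where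
  "positions W t \<epsilon> p = {i. i < length t \<and> sub_refl W t \<epsilon> i = p}"

definition flip :: "nat set \<Rightarrow> bool list \<Rightarrow> bool list" where
  "flip Y \<epsilon> = map (\<lambda>i. if i \<in> Y then \<not> \<epsilon> ! i else \<epsilon> ! i) [0..<length \<epsilon>]"

text \<open>\<open>card {x \<in> X. y \<le> x}\<close> is the position of \<open>y\<close> in \<open>X\<close> counted decreasingly from \<open>1\<close>.\<close>

definition odd_count :: "nat set \<Rightarrow> nat set \<Rightarrow> nat" where
  "odd_count X Y = card {y \<in> Y. odd (card {x \<in> X. y \<le> x})}"

definition alt_sum :: "bool list \<Rightarrow> nat set \<Rightarrow> (bool list \<Rightarrow> 'r) \<Rightarrow> 'r::comm_ring_1" where
  "alt_sum \<epsilon> X g = (\<Sum>Y\<in>Pow X. (- 1) ^ odd_count X Y * g (flip Y \<epsilon>))"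

definition fun_ring :: "'i set \<Rightarrow> 'r::comm_ring_1 set \<Rightarrow> ('i \<Rightarrow> 'r) ring" where
  "fun_ring I R =
     \<lparr>carrier = I \<rightarrow>\<^sub>E R,
      mult = (\<lambda>f g. \<lambda>i\<in>I. f i * g i),
      one = (\<lambda>i\<in>I. 1),
      zero = (\<lambda>i\<in>I. 0),
      add = (\<lambda>f g. \<lambda>i\<in>I. f i + g i)\<rparr>"

definition expr_ring :: "'r::comm_ring_1 set \<Rightarrow> ('w \<Rightarrow> 'r \<Rightarrow> 'r) \<Rightarrow> 'w list \<Rightarrow> ('r list \<Rightarrow>\<^sub>0 int) set ring"
where
  "expr_ring R act t = tensor_ring R (map (invariants R act) t)"

definition loc_tuple ::
  "('w, 'b) monoid_scheme \<Rightarrow> ('w \<Rightarrow> 'r \<Rightarrow> 'r) \<Rightarrow> 'w list \<Rightarrow> 'r list \<Rightarrow> bool list \<Rightarrow> 'r::comm_ring_1"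
where
  "loc_tuple W act t xs \<epsilon> = (\<Prod>i\<le>length t. act (prefix_prod W t \<epsilon> i) (xs ! i))"

definition loc_free ::
  "('w, 'b) monoid_scheme \<Rightarrow> ('w \<Rightarrow> 'r \<Rightarrow> 'r) \<Rightarrow> 'w list \<Rightarrow> ('r list \<Rightarrow>\<^sub>0 int) \<Rightarrow> bool list \<Rightarrow> 'r::comm_ring_1"
where
  "loc_free W act t c =
     (\<lambda>\<epsilon>\<in>Sub t. \<Sum>xs\<in>Poly_Mapping.keys c. of_int (Poly_Mapping.lookup c xs) * loc_tuple W act t xs \<epsilon>)"

text \<open>
  Elements of \<open>expr_ring R act t\<close> are cosets, on which \<open>loc_free\<close> is constant;
  see \<open>Loc_add\<close> and \<open>Loc_pure_tensor\<close> below.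
\<close>

definition Loc ::
  "('w, 'b) monoid_scheme \<Rightarrow> ('w \<Rightarrow> 'r \<Rightarrow> 'r) \<Rightarrow> 'w list \<Rightarrow> ('r list \<Rightarrow>\<^sub>0 int) set \<Rightarrow> bool list \<Rightarrow> 'r::comm_ring_1"
where
  "Loc W act t C = the_elem (loc_free W act t ` C)"

definition local_functions ::
  "('w, 'b) monoid_scheme \<Rightarrow> 'w set \<Rightarrow> 'r set \<Rightarrow> ('w \<Rightarrow> 'r) \<Rightarrow> 'w list \<Rightarrow> (bool list \<Rightarrow> 'r::comm_ring_1) set"
where
  "local_functions W S R rt t =
     {g \<in> carrier (fun_ring (Sub t) R).
        \<forall>p\<in>reflections W S. \<forall>\<epsilon>\<in>Sub t. \<forall>X\<subseteq>positions W t \<epsilon> p.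
          alt_sum \<epsilon> X g \<in> {rt p ^ card X * r | r. r \<in> R}}"


section \<open>Well-definedness\<close>

subsection \<open>Evaluation of polynomials\<close>

lemma mpoly_eval_superset:
  assumes "finite A" "Poly_Mapping.keys p \<subseteq> A" "h 0 = 0"
  shows "mpoly_eval h f p = (\<Sum>m\<in>A. h (Poly_Mapping.lookup p m) * mono_eval f m)"
  unfolding mpoly_eval_def using assms
  by (intro sum.mono_neutral_left) (auto simp: in_keys_iff)

lemma mono_eval_superset:
  assumes "finite A" "Poly_Mapping.keys m \<subseteq> A"
  shows "mono_eval f m = (\<Prod>i\<in>A. f i ^ Poly_Mapping.lookup m i)"
  unfolding mono_eval_def using assms
  by (intro prod.mono_neutral_left) (auto simp: in_keys_iff)

lemma mono_eval_add: "mono_eval f (a + b) = mono_eval f a * mono_eval f b"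
proof -
  let ?A = "Poly_Mapping.keys a \<union> Poly_Mapping.keys b"
  have "mono_eval f (a + b) = (\<Prod>i\<in>?A. f i ^ Poly_Mapping.lookup (a + b) i)"
    using keys_add[of a b] by (intro mono_eval_superset) auto
  also have "\<dots> = (\<Prod>i\<in>?A. f i ^ Poly_Mapping.lookup a i) * (\<Prod>i\<in>?A. f i ^ Poly_Mapping.lookup b i)"
    by (simp add: lookup_add power_add prod.distrib)
  also have "\<dots> = mono_eval f a * mono_eval f b"
    by (simp add: mono_eval_superset[of ?A])
  finally show ?thesis .
qed

lemma mono_eval_zero [simp]: "mono_eval f 0 = 1"
  by (simp add: mono_eval_def)

lemma mono_eval_single [simp]: "mono_eval f (Poly_Mapping.single i k) = f i ^ k"
  by (cases "k = 0") (simp_all add: mono_eval_def)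

lemma mpoly_sum_singles:
  "(\<Sum>m\<in>Poly_Mapping.keys p. Poly_Mapping.single m (Poly_Mapping.lookup p m)) = p"
  by (rule poly_mapping_eqI)
    (simp add: lookup_sum lookup_single when_def sum.delta in_keys_iff)

lemma mpoly_eval_zero [simp]: "mpoly_eval h f 0 = 0"
  by (simp add: mpoly_eval_def)

locale coeff_hom =
  fixes h :: "'k::comm_ring_1 \<Rightarrow> 'c::comm_ring_1"
  assumes h_0 [simp]: "h 0 = 0" and h_1 [simp]: "h 1 = 1"
    and h_add: "h (x + y) = h x + h y" and h_mult: "h (x * y) = h x * h y"
begin

lemma mpoly_eval_add: "mpoly_eval h f (p + q) = mpoly_eval h f p + mpoly_eval h f q"
proof -
  let ?A = "Poly_Mapping.keys p \<union> Poly_Mapping.keys q"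
  have "mpoly_eval h f (p + q) = (\<Sum>m\<in>?A. h (Poly_Mapping.lookup (p + q) m) * mono_eval f m)"
    using keys_add[of p q] by (intro mpoly_eval_superset) auto
  also have "\<dots> = (\<Sum>m\<in>?A. h (Poly_Mapping.lookup p m) * mono_eval f m)
      + (\<Sum>m\<in>?A. h (Poly_Mapping.lookup q m) * mono_eval f m)"
    by (simp add: lookup_add h_add algebra_simps sum.distrib)
  also have "\<dots> = mpoly_eval h f p + mpoly_eval h f q"
    by (simp add: mpoly_eval_superset[of ?A])
  finally show ?thesis .
qed

lemma mpoly_eval_sum: "mpoly_eval h f (sum g A) = (\<Sum>x\<in>A. mpoly_eval h f (g x))"
  by (induction A rule: infinite_finite_induct) (simp_all add: mpoly_eval_add)

lemma mpoly_eval_single [simp]: "mpoly_eval h f (Poly_Mapping.single m c) = h c * mono_eval f m"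
  by (cases "c = 0") (simp_all add: mpoly_eval_def)

lemma mpoly_eval_mult: "mpoly_eval h f (p * q) = mpoly_eval h f p * mpoly_eval h f q"
proof -
  have "p * q = (\<Sum>a\<in>Poly_Mapping.keys p. \<Sum>b\<in>Poly_Mapping.keys q.
      Poly_Mapping.single (a + b) (Poly_Mapping.lookup p a * Poly_Mapping.lookup q b))"
    by (subst mpoly_sum_singles[of p, symmetric], subst mpoly_sum_singles[of q, symmetric])
      (simp add: sum_product mult_single)
  then have "mpoly_eval h f (p * q) = (\<Sum>a\<in>Poly_Mapping.keys p. \<Sum>b\<in>Poly_Mapping.keys q.
      h (Poly_Mapping.lookup p a * Poly_Mapping.lookup q b) * mono_eval f (a + b))"
    by (simp only: mpoly_eval_sum mpoly_eval_single)
  also have "\<dots> = mpoly_eval h f p * mpoly_eval h f q"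
    by (simp add: h_mult mono_eval_add mpoly_eval_def sum_product mult_ac)
  finally show ?thesis .
qed

lemma mpoly_eval_one [simp]: "mpoly_eval h f 1 = 1"
  using mpoly_eval_single[of f 0 1] by simp

lemma mpoly_eval_mconst [simp]: "mpoly_eval h f (mconst c) = h c"
  by (simp add: mconst_def)

lemma mpoly_eval_mvar [simp]: "mpoly_eval h f (mvar i) = f i"
  by (simp add: mvar_def)

end

lemma coeff_hom_mconst: "coeff_hom (mconst :: 'k::comm_ring_1 \<Rightarrow> 'k mpoly)"
  by unfold_locales (simp_all add: mconst_def single_add mult_single)

interpretation mconst: coeff_hom "mconst :: 'k::comm_ring_1 \<Rightarrow> 'k mpoly"
  by (rule coeff_hom_mconst)

lemma mpoly_eval_cong:
  assumes "p \<in> Sym n" "\<And>i. i < n \<Longrightarrow> f i = g i"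
  shows "mpoly_eval h f p = mpoly_eval h g p"
proof -
  have "mono_eval f m = mono_eval g m" if "m \<in> Poly_Mapping.keys p" for m
    unfolding mono_eval_def
  proof (rule prod.cong)
    fix i assume "i \<in> Poly_Mapping.keys m"
    then have "i < n" using assms(1) that by (auto simp: Sym_def)
    then show "f i ^ Poly_Mapping.lookup m i = g i ^ Poly_Mapping.lookup m i"
      by (simp add: assms(2))
  qed simp
  then show ?thesis by (simp add: mpoly_eval_def)
qed

lemma mpoly_hom_eqI:
  fixes F G :: "'k::comm_ring_1 mpoly \<Rightarrow> 'c::comm_ring_1"
  assumes F: "\<And>p q. F (p + q) = F p + F q" "\<And>p q. F (p * q) = F p * F q" "F 1 = 1"
    and G: "\<And>p q. G (p + q) = G p + G q" "\<And>p q. G (p * q) = G p * G q" "G 1 = 1"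
    and "\<And>c. F (mconst c) = G (mconst c)" "\<And>i. F (mvar i) = G (mvar i)"
  shows "F p = G p"
proof -
  have sum: "H (sum g A) = (\<Sum>x\<in>A. H (g x))"
    if "\<And>p q. H (p + q) = H p + H q"
    for H :: "'k mpoly \<Rightarrow> 'c" and g :: "(nat \<Rightarrow>\<^sub>0 nat) \<Rightarrow> 'k mpoly" and A
  proof -
    have "H 0 = 0" using that[of 0 0] by simp
    then show ?thesis by (induction A rule: infinite_finite_induct) (simp_all add: that)
  qed
  have pow: "H (x ^ k) = H x ^ k" if "\<And>p q. H (p * q) = H p * H q" "H 1 = 1"
    for H :: "'k mpoly \<Rightarrow> 'c" and x k
    by (induction k) (simp_all add: that)
  have prod: "H (prod g A) = (\<Prod>x\<in>A. H (g x))"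
    if "\<And>p q. H (p * q) = H p * H q" "H 1 = 1"
    for H :: "'k mpoly \<Rightarrow> 'c" and g :: "nat \<Rightarrow> 'k mpoly" and A
    by (induction A rule: infinite_finite_induct) (simp_all add: that)
  have mvar_pow: "mvar i ^ k = (Poly_Mapping.single (Poly_Mapping.single i k) 1 :: 'k mpoly)" for i k
  proof (induction k)
    case (Suc k)
    then show ?case
      by (simp add: mvar_def mult_single flip: single_add)
  qed simp
  have prod_single: "(\<Prod>i\<in>A. Poly_Mapping.single (g i) (1::'k)) = Poly_Mapping.single (\<Sum>i\<in>A. g i) 1"
    if "finite A" for A and g :: "nat \<Rightarrow> nat \<Rightarrow>\<^sub>0 nat"
    using that by induction (simp_all add: mult_single)
  have mono: "Poly_Mapping.single m c
      = mconst c * (\<Prod>i\<in>Poly_Mapping.keys m. mvar i ^ Poly_Mapping.lookup m i)" for m and c :: 'k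
    by (simp add: mvar_pow prod_single mpoly_sum_singles mconst_def mult_single)
  have "F (Poly_Mapping.single m c) = G (Poly_Mapping.single m c)" for m c
    unfolding mono using assms(7,8) by (simp add: F(2,3) G(2,3) prod pow)
  then show ?thesis
    by (subst (1 2) mpoly_sum_singles[symmetric]) (simp add: sum F(1) G(1))
qed

subsection \<open>Functoriality of the symmetric algebra\<close>

lemma Sym_0 [simp]: "0 \<in> Sym n" and Sym_mconst [simp]: "mconst c \<in> Sym n"
  by (simp_all add: Sym_def mconst_def)

lemma Sym_1 [simp]: "1 \<in> Sym n"
  by (simp add: Sym_def)

lemma Sym_mvar [simp]: "i < n \<Longrightarrow> mvar i \<in> Sym n"
  by (simp add: Sym_def mvar_def)

lemma Sym_add: "p \<in> Sym n \<Longrightarrow> q \<in> Sym n \<Longrightarrow> p + q \<in> Sym n"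
  using keys_add[of p q] by (auto simp: Sym_def)

lemma Sym_uminus: "(p :: 'k::ab_group_add mpoly) \<in> Sym n \<Longrightarrow> - p \<in> Sym n"
  by (simp add: Sym_def)

lemma Sym_mult:
  fixes p q :: "'k::comm_ring_1 mpoly"
  assumes "p \<in> Sym n" "q \<in> Sym n"
  shows "p * q \<in> Sym n"
  unfolding Sym_def
proof (rule CollectI, rule ballI)
  fix m assume "m \<in> Poly_Mapping.keys (p * q)"
  then obtain a b where "m = a + b" "a \<in> Poly_Mapping.keys p" "b \<in> Poly_Mapping.keys q"
    using keys_mult[of p q] by blast
  then show "Poly_Mapping.keys m \<subseteq> {..<n}"
    using assms keys_add[of a b] unfolding Sym_def by blast
qed

lemma Sym_sum: "(\<And>x. x \<in> A \<Longrightarrow> g x \<in> Sym n) \<Longrightarrow> sum g A \<in> Sym n"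
  by (induction A rule: infinite_finite_induct) (auto intro: Sym_add)

lemma Sym_prod:
  fixes g :: "'x \<Rightarrow> 'k::comm_ring_1 mpoly"
  shows "(\<And>x. x \<in> A \<Longrightarrow> g x \<in> Sym n) \<Longrightarrow> prod g A \<in> Sym n"
  by (induction A rule: infinite_finite_induct) (auto intro: Sym_mult)

lemma Sym_power: "(p :: 'k::comm_ring_1 mpoly) \<in> Sym n \<Longrightarrow> p ^ k \<in> Sym n"
  by (induction k) (auto intro: Sym_mult)

locale basis_setting =
  fixes scale :: "'k::field \<Rightarrow> 'v::ab_group_add \<Rightarrow> 'v" and n :: nat and e :: "nat \<Rightarrow> 'v"
  assumes basis: "basis_family scale n e"
begin

sublocale fin: finite_dimensional_vector_space scale "e ` {..<n}"
  using basis by (simp add: basis_family_def)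

lemma inj_e: "inj_on e {..<n}"
  using basis by (simp add: basis_family_def)

abbreviation coord :: "nat \<Rightarrow> 'v \<Rightarrow> 'k" where
  "coord i v \<equiv> fin.representation (e ` {..<n}) v (e i)"

lemma coord_add: "coord i (u + v) = coord i u + coord i v"
  by (simp add: fin.representation_add fin.independent_Basis fin.span_Basis)

lemma coord_scale: "coord i (scale c v) = c * coord i v"
  by (simp add: fin.representation_scale fin.independent_Basis fin.span_Basis)

lemma coord_e: "i < n \<Longrightarrow> j < n \<Longrightarrow> coord i (e j) = (if i = j then 1 else 0)"
  using inj_e by (auto simp: fin.representation_basis fin.independent_Basis inj_on_eq_iff)

lemma coord_expansion: "(\<Sum>i<n. scale (coord i v) (e i)) = v"
  using fin.sum_representation_eq[of "e ` {..<n}" v "e ` {..<n}"] inj_e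
  by (simp add: fin.independent_Basis fin.span_Basis sum.reindex)

lemma sym_incl_add: "sym_incl scale n e (u + v) = sym_incl scale n e u + sym_incl scale n e v"
  by (simp add: sym_incl_def coord_add mconst.h_add algebra_simps sum.distrib)

lemma sym_incl_scale: "sym_incl scale n e (scale c v) = mconst c * sym_incl scale n e v"
  by (simp add: sym_incl_def coord_scale mconst.h_mult sum_distrib_left mult_ac)

lemma sym_incl_sum: "sym_incl scale n e (sum g A) = (\<Sum>x\<in>A. sym_incl scale n e (g x))"
proof -
  have "sym_incl scale n e 0 = 0" using sym_incl_scale[of 0 0] by simp
  then show ?thesis
    by (induction A rule: infinite_finite_induct) (simp_all add: sym_incl_add)
qed

lemma sym_incl_e: "i < n \<Longrightarrow> sym_incl scale n e (e i) = mvar i"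
  by (simp add: sym_incl_def coord_e if_distrib[of mconst] if_distrib[of "\<lambda>x. x * _"] cong: if_cong)

lemma sym_incl_Sym: "sym_incl scale n e v \<in> Sym n"
  by (auto simp: sym_incl_def intro!: Sym_sum Sym_mult)

lemma sym_map_add: "sym_map scale n e f (p + q) = sym_map scale n e f p + sym_map scale n e f q"
  and sym_map_mult: "sym_map scale n e f (p * q) = sym_map scale n e f p * sym_map scale n e f q"
  and sym_map_0 [simp]: "sym_map scale n e f 0 = 0"
  and sym_map_1 [simp]: "sym_map scale n e f 1 = 1"
  and sym_map_mconst [simp]: "sym_map scale n e f (mconst c) = mconst c"
  and sym_map_sum: "sym_map scale n e f (sum g A) = (\<Sum>x\<in>A. sym_map scale n e f (g x))"
  by (simp_all add: sym_map_def mconst.mpoly_eval_add mconst.mpoly_eval_mult mconst.mpoly_eval_sum)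

lemma sym_map_mvar:
  "sym_map scale n e f (mvar i) = (if i < n then sym_incl scale n e (f (e i)) else mvar i)"
  by (simp add: sym_map_def)

lemma sym_map_incl:
  assumes "Vector_Spaces.linear scale scale f"
  shows "sym_map scale n e f (sym_incl scale n e v) = sym_incl scale n e (f v)"
proof -
  interpret f: Vector_Spaces.linear scale scale f by fact
  have "sym_map scale n e f (sym_incl scale n e v)
      = sym_incl scale n e (\<Sum>i<n. scale (coord i v) (f (e i)))"
    unfolding sym_incl_def[of scale n e v]
    by (simp add: sym_map_sum sym_map_mult sym_map_mvar sym_incl_sum sym_incl_scale)
  also have "(\<Sum>i<n. scale (coord i v) (f (e i))) = f v"
    by (subst (2) coord_expansion[of v, symmetric]) (simp add: f.sum f.scale)
  finally show ?thesis .
qed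

lemma sym_map_compose:
  assumes "Vector_Spaces.linear scale scale f"
  shows "sym_map scale n e f (sym_map scale n e g p) = sym_map scale n e (f \<circ> g) p"
  by (rule mpoly_hom_eqI[where F = "\<lambda>p. sym_map scale n e f (sym_map scale n e g p)"])
    (simp_all add: sym_map_add sym_map_mult sym_map_mvar sym_map_incl[OF assms])

lemma sym_map_id: "sym_map scale n e (\<lambda>v. v) p = p"
  by (rule mpoly_hom_eqI[where G = "\<lambda>p. p"])
    (simp_all add: sym_map_add sym_map_mult sym_map_mvar sym_incl_e)

lemma sym_map_Sym:
  assumes "p \<in> Sym n" shows "sym_map scale n e f p \<in> Sym n"
proof -
  have "mono_eval (\<lambda>i. if i < n then sym_incl scale n e (f (e i)) else mvar i) m \<in> Sym n"
    if "m \<in> Poly_Mapping.keys p" for m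
    unfolding mono_eval_def
  proof (intro Sym_prod Sym_power)
    fix i assume "i \<in> Poly_Mapping.keys m"
    then have "i < n" using assms that by (auto simp: Sym_def)
    then show "(if i < n then sym_incl scale n e (f (e i)) else mvar i) \<in> Sym n"
      by (simp add: sym_incl_Sym)
  qed
  then show ?thesis
    unfolding sym_map_def mpoly_eval_def by (intro Sym_sum Sym_mult) simp_all
qed

end

subsection \<open>The action on the localization\<close>

lemma fract_map_Fract:
  fixes f :: "'a::idom \<Rightarrow> 'a"
  assumes mult: "\<And>x y. f (x * y) = f x * f y" and zero: "\<And>x. f x = 0 \<longleftrightarrow> x = 0"
  shows "fract_map f (Fraction_Field.Fract a b) = Fraction_Field.Fract (f a) (f b)"
proof -
  have *: "fract_map f (Fraction_Field.Fract a b) = Fraction_Field.Fract (f a) (f b)"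
    if "b \<noteq> 0" for a b
    unfolding fract_map_def
  proof (rule the_equality)
    fix r assume "\<exists>c d. d \<noteq> 0 \<and> Fraction_Field.Fract a b = Fraction_Field.Fract c d \<and>
      r = Fraction_Field.Fract (f c) (f d)"
    then obtain c d where cd: "d \<noteq> 0" "Fraction_Field.Fract a b = Fraction_Field.Fract c d"
        "r = Fraction_Field.Fract (f c) (f d)"
      by blast
    have "a * d = c * b" using cd(1,2) that by (simp add: eq_fract)
    then have "f a * f d = f c * f b" by (metis mult)
    with cd(1,3) that show "r = Fraction_Field.Fract (f a) (f b)"
      by (simp add: eq_fract zero)
  qed (use that in blast)
  show ?thesis
  proof (cases "b = 0")
    case True
    have 0: "f 0 = 0" by (simp add: zero)
    have "f 1 \<noteq> 0" by (simp add: zero)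
    then have "Fraction_Field.Fract 0 (f 1) = Fraction_Field.Fract 0 1" by (simp add: eq_fract)
    moreover have "fract_map f (Fraction_Field.Fract 0 1) = Fraction_Field.Fract (f 0) (f 1)"
      by (rule *) simp
    ultimately show ?thesis
      using True by (simp add: 0 eq_fract(2)[of a] eq_fract(2)[of "f a"])
  qed (rule *)
qed

locale ring_action =
  fixes W :: "('w, 'b) monoid_scheme" (structure)
    and R :: "'r::comm_ring_1 set" and act :: "'w \<Rightarrow> 'r \<Rightarrow> 'r"
  assumes group_W: "group W"
    and R_0 [simp]: "0 \<in> R" and R_1 [simp]: "1 \<in> R"
    and R_add: "x \<in> R \<Longrightarrow> y \<in> R \<Longrightarrow> x + y \<in> R"
    and R_uminus: "x \<in> R \<Longrightarrow> - x \<in> R"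
    and R_mult: "x \<in> R \<Longrightarrow> y \<in> R \<Longrightarrow> x * y \<in> R"
    and act_R: "w \<in> carrier W \<Longrightarrow> x \<in> R \<Longrightarrow> act w x \<in> R"
    and act_add: "w \<in> carrier W \<Longrightarrow> x \<in> R \<Longrightarrow> y \<in> R \<Longrightarrow> act w (x + y) = act w x + act w y"
    and act_mult: "w \<in> carrier W \<Longrightarrow> x \<in> R \<Longrightarrow> y \<in> R \<Longrightarrow> act w (x * y) = act w x * act w y"
    and act_one [simp]: "x \<in> R \<Longrightarrow> act \<one> x = x"
    and act_comp: "\<lbrakk>u \<in> carrier W; w \<in> carrier W; x \<in> R\<rbrakk> \<Longrightarrow> act (u \<otimes> w) x = act u (act w x)"

lemma ring_action_localization:
  fixes W :: "('w, 'b) monoid_scheme" and scale :: "'k::field \<Rightarrow> 'v::ab_group_add \<Rightarrow> 'v"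
    and \<sigma> :: "'k mpoly set"
  assumes "basis_family scale n e" "faithful_action W UNIV \<rho>"
    and lin: "\<forall>w\<in>carrier W. Vector_Spaces.linear scale scale (\<rho> w)"
    and \<sigma>: "\<sigma> \<subseteq> Sym n" "1 \<in> \<sigma>" "\<forall>f\<in>\<sigma>. \<forall>g\<in>\<sigma>. f * g \<in> \<sigma>"
      "\<forall>w\<in>carrier W. \<forall>f\<in>\<sigma>. sym_map scale n e (\<rho> w) f \<in> \<sigma>"
  shows "ring_action W (localization (Sym n) \<sigma>) (\<lambda>w. fract_map (sym_map scale n e (\<rho> w)))"
proof -
  interpret basis_setting scale n e by unfold_locales fact
  interpret faithful_action W UNIV \<rho> by fact
  have grp: "group W" using group_hom by (simp add: group_hom_def)
  interpret W: group W by (rule grp)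
  let ?S = "\<lambda>w. sym_map scale n e (\<rho> w)"
  have \<rho>_one: "\<rho> \<one>\<^bsub>W\<^esub> = (\<lambda>v. v)"
    using id_eq_one by (simp add: restrict_def)
  have \<rho>_mult: "\<rho> (u \<otimes>\<^bsub>W\<^esub> w) = \<rho> u \<circ> \<rho> w" if "u \<in> carrier W" "w \<in> carrier W" for u w
    using composition_rule[of _ u w] that by (auto simp: fun_eq_iff)
  have S_mult: "?S (u \<otimes>\<^bsub>W\<^esub> w) p = ?S u (?S w p)" if "u \<in> carrier W" "w \<in> carrier W" for u w p
    using lin that by (simp add: \<rho>_mult sym_map_compose)
  have S_zero: "?S w p = 0 \<longleftrightarrow> p = 0" if "w \<in> carrier W" for w p
  proof
    assume "?S w p = 0"
    then have "?S (inv\<^bsub>W\<^esub> w \<otimes>\<^bsub>W\<^esub> w) p = 0"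
      using that by (subst S_mult) simp_all
    then show "p = 0" using that by (simp add: \<rho>_one sym_map_id)
  qed simp
  have FF: "fract_map (?S w) (Fraction_Field.Fract a b) = Fraction_Field.Fract (?S w a) (?S w b)"
    if "w \<in> carrier W" for w a b
    by (rule fract_map_Fract) (simp_all add: sym_map_mult S_zero that)
  define R where "R = localization (Sym n) \<sigma>"
  have RI: "Fraction_Field.Fract a s \<in> R" if "a \<in> Sym n" "s \<in> \<sigma>" for a s
    using that by (auto simp: R_def localization_def)
  have RE: "\<exists>a s. x = Fraction_Field.Fract a s \<and> s \<noteq> 0 \<and> a \<in> Sym n \<and> s \<in> \<sigma>" if "x \<in> R" for x
  proof -
    obtain a s where as: "x = Fraction_Field.Fract a s" "a \<in> Sym n" "s \<in> \<sigma>"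
      using \<open>x \<in> R\<close> by (auto simp: R_def localization_def)
    show ?thesis
    proof (cases "s = 0")
      case True
      with as have "x = Fraction_Field.Fract 0 1" by (simp add: eq_fract)
      then show ?thesis using \<sigma> Sym_0[of n] zero_neq_one by metis
    qed (use as in blast)
  qed
  show ?thesis
    unfolding R_def[symmetric]
  proof unfold_locales
    show "0 \<in> R" "1 \<in> R" using RI[of 0 1] RI[of 1 1] \<sigma> by (simp_all add: Zero_fract_def One_fract_def)
  next
    fix x y assume "x \<in> R" "y \<in> R"
    obtain a s where x: "x = Fraction_Field.Fract a s" "s \<noteq> 0" "a \<in> Sym n" "s \<in> \<sigma>"
      using RE[OF \<open>x \<in> R\<close>] by blast
    obtain b r where y: "y = Fraction_Field.Fract b r" "r \<noteq> 0" "b \<in> Sym n" "r \<in> \<sigma>"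
      using RE[OF \<open>y \<in> R\<close>] by blast
    show "x + y \<in> R" "x * y \<in> R"
      using x y \<sigma> by (auto intro!: RI Sym_add Sym_mult)
    show "- x \<in> R" using x by (auto intro!: RI Sym_uminus)
    show "fract_map (?S \<one>\<^bsub>W\<^esub>) x = x"
      using x(1) FF[of "\<one>\<^bsub>W\<^esub>" a s] by (simp add: \<rho>_one sym_map_id)
    fix w assume w: "w \<in> carrier W"
    show "fract_map (?S w) x \<in> R" using x \<sigma> w by (auto simp: FF intro!: RI sym_map_Sym)
    show "fract_map (?S w) (x + y) = fract_map (?S w) x + fract_map (?S w) y"
      "fract_map (?S w) (x * y) = fract_map (?S w) x * fract_map (?S w) y"
      using x y w by (simp_all add: FF S_zero sym_map_add sym_map_mult)
    fix u assume u: "u \<in> carrier W"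
    show "fract_map (?S (u \<otimes>\<^bsub>W\<^esub> w)) x = fract_map (?S u) (fract_map (?S w) x)"
      using x u w by (simp add: FF S_mult)
  qed
qed

subsection \<open>Localization maps\<close>

context ring_action
begin

lemma frag_cmul_of_int_sum:
  "(\<Sum>xs\<in>Poly_Mapping.keys c. of_int (Poly_Mapping.lookup c xs) * F xs)
    = (\<Sum>xs\<in>A. of_int (Poly_Mapping.lookup c xs) * (F xs :: 'r))"
  if "finite A" "Poly_Mapping.keys c \<subseteq> A"
  using that by (intro sum.mono_neutral_left) (auto simp: in_keys_iff)

lemma loc_free_add:
  "loc_free W act t (c + d) = (\<lambda>\<epsilon>\<in>Sub t. loc_free W act t c \<epsilon> + loc_free W act t d \<epsilon>)"
proof -
  let ?A = "Poly_Mapping.keys c \<union> Poly_Mapping.keys d"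
  have "(\<Sum>xs\<in>Poly_Mapping.keys (c + d). of_int (Poly_Mapping.lookup (c + d) xs) * F xs)
     = (\<Sum>xs\<in>Poly_Mapping.keys c. of_int (Poly_Mapping.lookup c xs) * F xs)
      + (\<Sum>xs\<in>Poly_Mapping.keys d. of_int (Poly_Mapping.lookup d xs) * F xs)" for F :: "'r list \<Rightarrow> 'r"
    using frag_cmul_of_int_sum[OF _ keys_add, of c d F]
      frag_cmul_of_int_sum[of ?A c F] frag_cmul_of_int_sum[of ?A d F]
    by (simp add: lookup_add distrib_right sum.distrib)
  then show ?thesis by (auto simp: loc_free_def)
qed

lemma loc_free_uminus:
  "loc_free W act t (- c) = (\<lambda>\<epsilon>\<in>Sub t. - loc_free W act t c \<epsilon>)"
  by (auto simp: loc_free_def sum_negf)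

lemma loc_free_diff:
  "loc_free W act t (c - d) = (\<lambda>\<epsilon>\<in>Sub t. loc_free W act t c \<epsilon> - loc_free W act t d \<epsilon>)"
  using loc_free_add[of t c "- d"] by (auto simp: loc_free_uminus)

lemma loc_free_frag_of:
  "loc_free W act t (frag_of xs) = (\<lambda>\<epsilon>\<in>Sub t. loc_tuple W act t xs \<epsilon>)"
  by (auto simp: loc_free_def)

end

locale reflection_expression = ring_action +
  fixes t :: "'a list"
  assumes t_carrier: "set t \<subseteq> carrier W"
begin

abbreviation "As \<equiv> map (invariants R act) t"
abbreviation "F \<equiv> tuple_ring R (Suc (length t))"

lemma prefix_prod_closed:
  assumes "i \<le> length t" shows "prefix_prod W t \<epsilon> i \<in> carrier W"
proof -
  interpret group W by (rule group_W)
  have "list_prod W xs \<in> carrier W" if "set xs \<subseteq> carrier W" for xs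
    using that by (induction xs) (simp_all add: list_prod_def)
  moreover have "set (map (\<lambda>j. if \<epsilon> ! j then t ! j else \<one>) [0..<i]) \<subseteq> carrier W"
    using assms t_carrier nth_mem[of _ t] by force
  ultimately show ?thesis by (simp only: prefix_prod_def)
qed

lemma prefix_prod_Suc:
  assumes "i < length t"
  shows "prefix_prod W t \<epsilon> (Suc i) = prefix_prod W t \<epsilon> i \<otimes> (if \<epsilon> ! i then t ! i else \<one>)"
proof -
  interpret group W by (rule group_W)
  have snoc: "list_prod W (xs @ [x]) = list_prod W xs \<otimes> x"
    if "set xs \<subseteq> carrier W" "x \<in> carrier W" for xs x
  proof -
    have cl: "list_prod W ys \<in> carrier W" if "set ys \<subseteq> carrier W" for ys
      using that by (induction ys) (simp_all add: list_prod_def)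
    show ?thesis
      using that
    proof (induction xs)
      case (Cons y ys)
      then show ?case using cl[of ys] by (simp add: list_prod_def m_assoc)
    qed (simp add: list_prod_def)
  qed
  have "set (map (\<lambda>j. if \<epsilon> ! j then t ! j else \<one>) [0..<i]) \<subseteq> carrier W"
    "(if \<epsilon> ! i then t ! i else \<one>) \<in> carrier W"
    using assms t_carrier nth_mem[of _ t] by force+
  from snoc[OF this] show ?thesis by (simp add: prefix_prod_def)
qed

lemma loc_tuple_split:
  assumes "i \<le> length t"
  shows "loc_tuple W act t xs \<epsilon> = act (prefix_prod W t \<epsilon> i) (xs ! i)
     * (\<Prod>j\<in>{..length t} - {i}. act (prefix_prod W t \<epsilon> j) (xs ! j))"
  unfolding loc_tuple_def using assms by (subst prod.remove[of _ i]) auto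

lemma loc_tuple_update:
  assumes "i \<le> length t" "length xs = Suc (length t)"
  shows "loc_tuple W act t (xs[i := a]) \<epsilon> = act (prefix_prod W t \<epsilon> i) a
     * (\<Prod>j\<in>{..length t} - {i}. act (prefix_prod W t \<epsilon> j) (xs ! j))"
proof -
  have "(\<Prod>j\<in>{..length t} - {i}. act (prefix_prod W t \<epsilon> j) (xs[i := a] ! j))
      = (\<Prod>j\<in>{..length t} - {i}. act (prefix_prod W t \<epsilon> j) (xs ! j))"
    by (intro prod.cong) auto
  then show ?thesis using assms by (simp add: loc_tuple_split[OF assms(1)])
qed

lemma loc_free_rels:
  assumes "c \<in> tensor_rels R As"
  shows "loc_free W act t c = (\<lambda>\<epsilon>\<in>Sub t. 0)"
proof -
  have nth_R: "xs ! i \<in> R" if "xs \<in> tuples R (Suc (length t))" "i \<le> length t" for xs i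
    using that nth_mem[of i xs] by (auto simp: tuples_def)
  show ?thesis
    using assms unfolding tensor_rels_def length_map
  proof (elim UnE CollectE exE conjE)
    fix xs i a b
    assume add: "xs \<in> tuples R (Suc (length t))" "i < Suc (length t)" "a \<in> R" "b \<in> R"
      "c = frag_of (xs[i := a + b]) - frag_of (xs[i := a]) - frag_of (xs[i := b])"
    have "loc_tuple W act t (xs[i := a + b]) \<epsilon>
        = loc_tuple W act t (xs[i := a]) \<epsilon> + loc_tuple W act t (xs[i := b]) \<epsilon>" for \<epsilon>
      using add(1-4) by (simp add: tuples_def loc_tuple_update act_add prefix_prod_closed distrib_right)
    then show ?thesis
      by (auto simp: add(5) loc_free_diff loc_free_frag_of)
  next
    fix xs i r
    assume bal: "xs \<in> tuples R (Suc (length t))" "i < length t" "r \<in> As ! i"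
      "c = frag_of (xs[i := xs ! i * r]) - frag_of (xs[Suc i := r * xs ! Suc i])"
    have r: "r \<in> R" "act (t ! i) r = r" using bal by (auto simp: invariants_def)
    have ti: "t ! i \<in> carrier W" using bal t_carrier nth_mem by blast
    interpret group W by (rule group_W)
    have "act (prefix_prod W t \<epsilon> (Suc i)) r = act (prefix_prod W t \<epsilon> i) r" for \<epsilon>
      using bal r ti by (auto simp: prefix_prod_Suc act_comp prefix_prod_closed)
    then have "loc_tuple W act t (xs[i := xs ! i * r]) \<epsilon>
        = loc_tuple W act t (xs[Suc i := r * xs ! Suc i]) \<epsilon>" for \<epsilon>
      using bal(1,2) r nth_R[of xs i] nth_R[of xs "Suc i"]
        loc_tuple_split[of i xs \<epsilon>] loc_tuple_split[of "Suc i" xs \<epsilon>]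
      by (simp add: loc_tuple_update tuples_def act_mult prefix_prod_closed mult_ac)
    then show ?thesis
      by (auto simp: bal(4) loc_free_diff loc_free_frag_of)
  qed
qed

lemma add_monoid_tuple_ring: "add_monoid F = free_Abelian_group (tuples R (Suc (length t)))"
  by (simp add: tuple_ring_def free_Abelian_group_def)

lemma tensor_rels_carrier: "tensor_rels R As \<subseteq> carrier F"
proof -
  have "xs[i := a] \<in> tuples R k" if "xs \<in> tuples R k" "a \<in> R" for xs i a k
    using that set_update_subset_insert[of xs i a] by (auto simp: tuples_def)
  moreover have "xs ! i \<in> R" if "xs \<in> tuples R k" "i < k" for xs i k
    using that nth_mem[of i xs] by (auto simp: tuples_def)
  ultimately show ?thesis
    unfolding tensor_rels_def tuple_ring_def
    by (auto simp: invariants_def R_add R_mult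
        dest!: subsetD[OF keys_diff])
qed

lemma tensor_ideal_subgroup: "subgroup (tensor_ideal R As) (add_monoid F)"
proof -
  have "group (add_monoid F)" by (simp only: add_monoid_tuple_ring group_free_Abelian_group)
  then show ?thesis
    unfolding tensor_ideal_def length_map
    by (rule group.generate_is_subgroup) (simp add: tensor_rels_carrier)
qed

lemma loc_free_ideal:
  assumes "c \<in> tensor_ideal R As" shows "loc_free W act t c = (\<lambda>\<epsilon>\<in>Sub t. 0)"
  using assms unfolding tensor_ideal_def length_map add_monoid_tuple_ring
proof (induction rule: generate.induct)
  case (inv h)
  then have "inv\<^bsub>free_Abelian_group (tuples R (Suc (length t)))\<^esub> h = - h"
    using tensor_rels_carrier by (intro inv_free_Abelian_group) (auto simp: tuple_ring_def)
  then show ?case using inv by (simp add: loc_free_uminus loc_free_rels cong: restrict_cong)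
qed (simp_all add: loc_free_rels loc_free_add cong: restrict_cong, simp add: loc_free_def)

lemma Loc_coset:
  assumes "c \<in> carrier F"
  shows "Loc W act t (tensor_ideal R As +>\<^bsub>F\<^esub> c) = loc_free W act t c"
proof -
  have "loc_free W act t (h + c) = loc_free W act t c" if "h \<in> tensor_ideal R As" for h
    using that by (auto simp: loc_free_add loc_free_ideal) (auto simp: loc_free_def fun_eq_iff)
  moreover have "tensor_ideal R As \<noteq> {}"
    using subgroup.one_closed[OF tensor_ideal_subgroup] by blast
  moreover have "tensor_ideal R As +>\<^bsub>F\<^esub> c = (\<lambda>h. h + c) ` tensor_ideal R As"
    by (auto simp: a_r_coset_def r_coset_def tuple_ring_def)
  ultimately have "loc_free W act t ` (tensor_ideal R As +>\<^bsub>F\<^esub> c) = {loc_free W act t c}"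
    by (auto simp: image_image)
  then show ?thesis by (simp add: Loc_def)
qed

theorem Loc_pure_tensor:
  assumes "xs \<in> tuples R (Suc (length t))" "\<epsilon> \<in> Sub t"
  shows "Loc W act t (pure_tensor R As xs) \<epsilon> = (\<Prod>i\<le>length t. act (prefix_prod W t \<epsilon> i) (xs ! i))"
  using assms Loc_coset[of "frag_of xs"]
  by (simp add: pure_tensor_def loc_free_frag_of loc_tuple_def tuple_ring_def)

theorem Loc_add:
  assumes "C \<in> carrier (expr_ring R act t)" "D \<in> carrier (expr_ring R act t)"
  shows "Loc W act t (C \<oplus>\<^bsub>expr_ring R act t\<^esub> D)
    = Loc W act t C \<oplus>\<^bsub>fun_ring (Sub t) R\<^esub> Loc W act t D"
proof -
  obtain c d where cd: "c \<in> carrier F" "C = tensor_ideal R As +>\<^bsub>F\<^esub> c"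
      "d \<in> carrier F" "D = tensor_ideal R As +>\<^bsub>F\<^esub> d"
    using assms by (auto simp: expr_ring_def tensor_ring_def FactRing_def A_RCOSETS_def
        RCOSETS_def a_r_coset_def)
  have comm: "comm_group (add_monoid F)"
    by (simp only: add_monoid_tuple_ring abelian_free_Abelian_group)
  then have "tensor_ideal R As \<lhd> add_monoid F"
    using tensor_ideal_subgroup by (simp add: comm_group.normal_iff_subgroup)
  then have "C \<oplus>\<^bsub>expr_ring R act t\<^esub> D = tensor_ideal R As +>\<^bsub>F\<^esub> (c + d)"
    using cd normal.rcos_sum[of "tensor_ideal R As" "add_monoid F" c d]
    by (simp add: expr_ring_def tensor_ring_def FactRing_def set_add_def a_r_coset_def)
      (simp add: tuple_ring_def)
  moreover have "c + d \<in> carrier F"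
    using cd keys_add[of c d] by (auto simp: tuple_ring_def)
  ultimately show ?thesis
    by (simp add: cd(2,4) Loc_coset cd(1,3) loc_free_add fun_ring_def)
qed

end

end

theory Submission
  imports Defs
begin

text \<open>
  Both sides are compared along the removal of the last entry \<open>x\<close> of a reflection expression
  \<open>t @ [x]\<close>.  Since \<open>2\<close> is invertible and \<open>r - x r\<close> is divisible by \<open>\<alpha>\<^sub>x\<close>, every element of \<open>R\<close> is
  \<open>r + r' \<alpha>\<^sub>x\<close> with \<open>x\<close>-invariant \<open>r, r'\<close>, so the tensors ending in \<open>1\<close> or \<open>\<alpha>\<^sub>x\<close> already generate.
  After localization such an element is a function \<open>g (\<epsilon>, b) = h\<^sub>0 \<epsilon> + (- 1) ^ b * \<beta>\<^sub>\<epsilon> * h\<^sub>1 \<epsilon>\<close>,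
  where \<open>\<beta>\<^sub>\<epsilon>\<close> is the image of \<open>\<alpha>\<^sub>x\<close> under the product of the subexpression \<open>\<epsilon>\<close>.  As \<open>h\<^sub>0\<close> and \<open>h\<^sub>1\<close>
  are recovered from \<open>g\<close> as half the sum of the two slices and as half their difference divided by
  \<open>\<beta>\<close>, the theorem amounts to: \<open>g\<close> satisfies the congruences for \<open>t @ [x]\<close> if and only if \<open>h\<^sub>0\<close> and
  \<open>h\<^sub>1\<close> satisfy those for \<open>t\<close>.

  The congruences survive multiplication by a weight such as \<open>\<beta>\<close> for the following reason.
  Flipping a set \<open>Y\<close> of positions that all carry the reflection \<open>p\<close> multiplies the partial products
  behind \<open>Y\<close> by \<open>p ^ card Y\<close> (\<open>prefix_prod_flip\<close>).  Hence the weight takes only two values \<open>w\<close> and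
  \<open>p w\<close>, according to the parity of \<open>card Y\<close>, and they differ by a multiple of \<open>\<alpha>\<^sub>p\<close>.  Write the weight
  as mean plus signed half-difference.  The mean contributes a multiple of an alternating sum.  The
  half-difference contributes a factor \<open>\<alpha>\<^sub>p\<close> times the alternating sum with the extra sign
  \<open>(- 1) ^ card Y\<close>; this twisted sum over \<open>X\<close> is a sum of two ordinary ones over \<open>X\<close> without its
  maximum (\<open>twisted_sum_insert_max\<close>), so exactly one power of \<open>\<alpha>\<^sub>p\<close> is lost, and the factor restores it
  (\<open>alt_sum_parity_weights\<close>).  Conversely an alternating sum over a set that contains the last position
  is a twisted sum of the difference of the two slices (\<open>alt_sum_insert_max\<close>).

  Division by \<open>\<beta>\<^sub>\<epsilon>\<close>, which is a unit times the root of a reflection \<open>q\<close>, has two cases.  If \<open>p = q\<close>, then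
  \<open>\<beta>\<close> changes sign under each flip and the alternating sum of \<open>h\<^sub>1\<close> is an alternating sum of \<open>g\<close> over one
  more position, divided by \<open>2 \<beta>\<^sub>\<epsilon>\<close>.  If \<open>p \<noteq> q\<close>, then multiplication by both values of \<open>\<beta>\<close> turns the
  quotient into a weighted sum as before, and both factors can be cancelled because roots of
  distinct reflections are coprime.

  Coprimality rests on the geometry of the representation.  The projection along \<open>\<alpha>\<^sub>p\<close> onto the fixed
  space of \<open>p\<close> induces an endomorphism of the symmetric algebra that vanishes exactly on the multiples
  of \<open>\<alpha>\<^sub>p\<close>.  So \<open>\<alpha>\<^sub>p\<close> is prime; by the GKM-condition it divides no other root, and by assumption no
  denominator.
\<close>

section \<open>Alternating sums over subexpressions\<close>

lemma flip_empty [simp]: "flip {} \<epsilon> = \<epsilon>"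
  by (simp add: flip_def map_nth)

lemma length_flip [simp]: "length (flip Y \<epsilon>) = length \<epsilon>"
  by (simp add: flip_def)

lemma flip_Sub [simp]: "flip Y \<epsilon> \<in> Sub t \<longleftrightarrow> \<epsilon> \<in> Sub t"
  by (simp add: Sub_def)

lemma nth_flip: "i < length \<epsilon> \<Longrightarrow> flip Y \<epsilon> ! i = (if i \<in> Y then \<not> \<epsilon> ! i else \<epsilon> ! i)"
  by (simp add: flip_def)

lemma flip_insert: "m \<notin> Y \<Longrightarrow> flip (insert m Y) \<epsilon> = flip Y (flip {m} \<epsilon>)"
  by (rule nth_equalityI) (auto simp: nth_flip)

lemma flip_snoc: "Y \<subseteq> {..<length \<epsilon>} \<Longrightarrow> flip Y (\<epsilon> @ [b]) = flip Y \<epsilon> @ [b]"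
  by (auto simp: flip_def nth_append intro!: nth_equalityI)

lemma flip_insert_snoc:
  "Y \<subseteq> {..<length \<epsilon>} \<Longrightarrow> flip (insert (length \<epsilon>) Y) (\<epsilon> @ [b]) = flip Y \<epsilon> @ [\<not> b]"
  by (rule nth_equalityI) (auto simp: nth_flip nth_append less_Suc_eq)

lemma Sub_snoc: "\<eta> \<in> Sub (t @ [x]) \<longleftrightarrow> (\<exists>\<epsilon>\<in>Sub t. \<exists>b. \<eta> = \<epsilon> @ [b])"
  by (auto simp: Sub_def length_Suc_conv_rev)

lemma odd_count_empty [simp]: "odd_count X {} = 0"
  by (simp add: odd_count_def)

text \<open>
  A new maximum moves every other element one position further, so odd and even positions are
  exchanged; the maximum itself sits at the odd position \<open>1\<close>.
\<close>

lemma odd_count_insert_max: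
  assumes "finite X" "\<And>x. x \<in> X \<Longrightarrow> x < m" "Y \<subseteq> X"
  shows "odd_count (insert m X) Y + odd_count X Y = card Y"
    and "odd_count (insert m X) (insert m Y) = Suc (odd_count (insert m X) Y)"
proof -
  have fin: "finite Y" and m: "m \<notin> Y" using assms finite_subset by blast+
  define c where "c y = card {x \<in> insert m X. y \<le> x}" for y
  have pos: "c y = Suc (card {x \<in> X. y \<le> x})" if "y \<in> Y" for y
  proof -
    have "{x \<in> insert m X. y \<le> x} = insert m {x \<in> X. y \<le> x}"
      using that assms by force
    moreover have "m \<notin> {x \<in> X. y \<le> x}" using assms(2) by blast
    ultimately show ?thesis using assms(1) by (simp add: c_def)
  qed
  have "{x \<in> insert m X. m \<le> x} = {m}" using assms(2) by (auto dest: leD)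
  then have top: "c m = 1" unfolding c_def by simp
  have count: "odd_count (insert m X) Z = card {y \<in> Z. odd (c y)}" for Z
    unfolding odd_count_def c_def ..
  have "odd_count (insert m X) Y = card {y \<in> Y. even (card {x \<in> X. y \<le> x})}"
    unfolding count by (rule arg_cong[where f = card]) (auto simp: pos)
  moreover have "{y \<in> Y. even (card {x \<in> X. y \<le> x})} \<union> {y \<in> Y. odd (card {x \<in> X. y \<le> x})} = Y"
    by blast
  ultimately show "odd_count (insert m X) Y + odd_count X Y = card Y"
    using card_Un_disjoint[of "{y \<in> Y. even (card {x \<in> X. y \<le> x})}"
        "{y \<in> Y. odd (card {x \<in> X. y \<le> x})}"] fin
    by (fastforce simp: odd_count_def[of X])
  have "{y \<in> insert m Y. odd (c y)} = insert m {y \<in> Y. odd (c y)}"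
    using top by auto
  then show "odd_count (insert m X) (insert m Y) = Suc (odd_count (insert m X) Y)"
    unfolding count using fin m by simp
qed

text \<open>
  The companion of \<open>alt_sum\<close> that counts the elements of \<open>Y\<close> at even positions instead of those at
  odd positions: the two exponents add up to \<open>card Y\<close>.
\<close>

definition twisted_sum :: "bool list \<Rightarrow> nat set \<Rightarrow> (bool list \<Rightarrow> 'r) \<Rightarrow> 'r::comm_ring_1" where
  "twisted_sum \<epsilon> X g = (\<Sum>Y\<in>Pow X. (- 1) ^ (card Y + odd_count X Y) * g (flip Y \<epsilon>))"

lemma sum_Pow_insert:
  fixes F :: "'x set \<Rightarrow> 'r::comm_monoid_add"
  assumes "finite X" "m \<notin> X"
  shows "(\<Sum>Y\<in>Pow (insert m X). F Y) = (\<Sum>Y\<in>Pow X. F Y + F (insert m Y))"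
proof -
  have "inj_on (insert m) (Pow X)" using assms(2) by (auto simp: inj_on_def)
  then show ?thesis
    using assms by (subst Pow_insert, subst sum.union_disjoint)
      (auto simp: sum.reindex sum.distrib)
qed

text \<open>
  The next two lemmas let \<open>alt_sum\<close> and \<open>twisted_sum\<close> pass into one another when the maximum is
  removed: subsets containing the maximum enter an alternating sum with the opposite sign and a
  twisted sum with the same sign as those without it.
\<close>

lemma alt_sum_insert_max:
  assumes "finite X" "\<And>x. x \<in> X \<Longrightarrow> x < m"
  shows "alt_sum \<epsilon> (insert m X) g = (\<Sum>Y\<in>Pow X. (- 1) ^ (card Y + odd_count X Y)
      * (g (flip Y \<epsilon>) - g (flip (insert m Y) \<epsilon>)))"
proof -
  have m: "m \<notin> X" using assms(2) by blast
  have "(- 1) ^ odd_count (insert m X) Y = ((- 1) ^ (card Y + odd_count X Y) :: 'a)"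
    if "Y \<subseteq> X" for Y
  proof -
    have "even (odd_count (insert m X) Y) \<longleftrightarrow> even (card Y + odd_count X Y)"
      using odd_count_insert_max(1)[OF assms that] by presburger
    then show ?thesis by (simp add: minus_one_power_iff)
  qed
  then show ?thesis
    unfolding alt_sum_def using odd_count_insert_max(2)[OF assms]
    by (subst sum_Pow_insert[OF assms(1) m]) (auto intro!: sum.cong simp: algebra_simps)
qed

lemma twisted_sum_insert_max:
  assumes "finite X" "\<And>x. x \<in> X \<Longrightarrow> x < m"
  shows "twisted_sum \<epsilon> (insert m X) g = alt_sum \<epsilon> X g + alt_sum (flip {m} \<epsilon>) X g"
proof -
  have m: "m \<notin> X" using assms(2) by blast
  have fin: "finite Y" if "Y \<subseteq> X" for Y using that assms(1) finite_subset by blast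
  have s: "(- 1) ^ (card Y + odd_count (insert m X) Y) = ((- 1) ^ odd_count X Y :: 'a)"
    if "Y \<subseteq> X" for Y
  proof -
    have "even (card Y + odd_count (insert m X) Y) \<longleftrightarrow> even (odd_count X Y)"
      using odd_count_insert_max(1)[OF assms that] by presburger
    then show ?thesis by (simp add: minus_one_power_iff)
  qed
  have s': "(- 1) ^ (card (insert m Y) + odd_count (insert m X) (insert m Y))
      = ((- 1) ^ odd_count X Y :: 'a)" if "Y \<subseteq> X" for Y
  proof -
    have "m \<notin> Y" using that m by blast
    then have "card (insert m Y) + odd_count (insert m X) (insert m Y)
        = 2 + (card Y + odd_count (insert m X) Y)"
      using that odd_count_insert_max(2)[OF assms that] by (simp add: fin)
    then show ?thesis using s[OF that] by (simp add: power_add)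
  qed
  have flips: "flip (insert m Y) \<epsilon> = flip Y (flip {m} \<epsilon>)" if "Y \<subseteq> X" for Y
    using that m by (intro flip_insert) blast
  show ?thesis
    unfolding twisted_sum_def alt_sum_def sum_Pow_insert[OF assms(1) m] sum.distrib[symmetric]
    by (intro sum.cong HOL.refl) (simp only: s s' flips Pow_iff)
qed

lemma alt_sum_snoc:
  assumes "X \<subseteq> {..<length \<epsilon>}"
  shows "alt_sum (\<epsilon> @ [b]) X g = alt_sum \<epsilon> X (\<lambda>\<eta>. g (\<eta> @ [b]))"
  unfolding alt_sum_def using assms by (intro sum.cong) (auto simp: flip_snoc)

lemma alt_sum_cong:
  assumes "\<epsilon> \<in> Sub t" "\<And>\<eta>. \<eta> \<in> Sub t \<Longrightarrow> f \<eta> = g \<eta>"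
  shows "alt_sum \<epsilon> X f = alt_sum \<epsilon> X g"
  unfolding alt_sum_def using assms by simp

lemma alt_sum_diff: "alt_sum \<epsilon> X (\<lambda>\<eta>. f \<eta> - g \<eta>) = alt_sum \<epsilon> X f - alt_sum \<epsilon> X g"
  and alt_sum_add: "alt_sum \<epsilon> X (\<lambda>\<eta>. f \<eta> + g \<eta>) = alt_sum \<epsilon> X f + alt_sum \<epsilon> X g"
  and alt_sum_cmult: "alt_sum \<epsilon> X (\<lambda>\<eta>. c * f \<eta>) = c * alt_sum \<epsilon> X f"
  unfolding alt_sum_def
  by (simp_all add: algebra_simps sum.distrib sum_subtractf sum_distrib_left)

lemma alt_sum_empty [simp]: "alt_sum \<epsilon> {} g = g \<epsilon>"
  by (simp add: alt_sum_def)

section \<open>Reflections acting on a ring with roots\<close>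

lemma (in group) reflections_carrier: "S \<subseteq> carrier G \<Longrightarrow> p \<in> reflections G S \<Longrightarrow> p \<in> carrier G"
  by (auto simp: reflections_def)

lemma (in group) reflections_conj:
  assumes S: "S \<subseteq> carrier G" and "w \<in> carrier G" and "p \<in> reflections G S"
  shows "w \<otimes> p \<otimes> inv w \<in> reflections G S"
proof -
  obtain v s where v: "v \<in> carrier G" "s \<in> S" "p = v \<otimes> s \<otimes> inv v"
    using assms(3) by (auto simp: reflections_def)
  then have s: "s \<in> carrier G" using S by blast
  have "w \<otimes> p \<otimes> inv w = (w \<otimes> v) \<otimes> s \<otimes> inv (w \<otimes> v)"
    using assms(2) v s by (simp add: m_assoc inv_mult_group)
  then show ?thesis using assms(2) v(1,2) unfolding reflections_def by blast
qed

text \<open>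
  All that the argument uses of the localized symmetric algebra: the roots are eigenvectors of
  their reflections, they are permuted by the group up to units, every difference \<open>x - p x\<close> is
  divisible by the root of \<open>p\<close>, and roots of distinct reflections are coprime.  The ambient
  field serves to divide by roots; membership in \<open>R\<close> records which quotients exist.
\<close>

locale root_ring_action = ring_action W R act
  for W :: "('w, 'b) monoid_scheme" (structure) and R :: "'r::field set" and act +
  fixes S :: "'w set" and rt :: "'w \<Rightarrow> 'r"
  assumes S_carrier: "S \<subseteq> carrier W"
    and reflection_square: "p \<in> reflections W S \<Longrightarrow> p \<otimes> p = \<one>"
    and two_nonzero: "(2::'r) \<noteq> 0"
    and half_R: "inverse 2 \<in> R"
    and rt_R: "p \<in> reflections W S \<Longrightarrow> rt p \<in> R"
    and rt_nonzero: "p \<in> reflections W S \<Longrightarrow> rt p \<noteq> 0"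
    and act_rt: "\<lbrakk>w \<in> carrier W; p \<in> reflections W S\<rbrakk> \<Longrightarrow>
      \<exists>c. c \<in> R \<and> inverse c \<in> R \<and> c \<noteq> 0 \<and> act w (rt p) = c * rt (w \<otimes> p \<otimes> inv w)"
    and act_rt_self: "p \<in> reflections W S \<Longrightarrow> act p (rt p) = - rt p"
    and reflection_diff: "\<lbrakk>p \<in> reflections W S; x \<in> R\<rbrakk> \<Longrightarrow> \<exists>y\<in>R. x - act p x = rt p * y"
    and rt_coprime: "\<lbrakk>p \<in> reflections W S; q \<in> reflections W S; p \<noteq> q; x \<in> R; y \<in> R;
      rt q * x = rt p * y\<rbrakk> \<Longrightarrow> \<exists>z\<in>R. x = rt p * z"
begin

sublocale W: group W
  by (rule group_W)

abbreviation "T \<equiv> reflections W S"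

lemma T_carrier: "p \<in> T \<Longrightarrow> p \<in> carrier W"
  using W.reflections_carrier[OF S_carrier] .

lemma conj_T: "w \<in> carrier W \<Longrightarrow> p \<in> T \<Longrightarrow> w \<otimes> p \<otimes> inv w \<in> T"
  using W.reflections_conj[OF S_carrier] .

lemma R_diff: "x \<in> R \<Longrightarrow> y \<in> R \<Longrightarrow> x - y \<in> R"
  using R_add[of x "- y"] R_uminus[of y] by simp

lemma R_power: "x \<in> R \<Longrightarrow> x ^ k \<in> R"
  by (induction k) (auto intro: R_mult)

lemma R_sum: "(\<And>i. i \<in> A \<Longrightarrow> f i \<in> R) \<Longrightarrow> sum f A \<in> R"
  by (induction A rule: infinite_finite_induct) (auto intro: R_add)

lemma act_zero: "w \<in> carrier W \<Longrightarrow> act w 0 = 0"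
  using act_add[of w 0 0] by (metis R_0 add.right_neutral add_left_cancel)

lemma act_uminus: "w \<in> carrier W \<Longrightarrow> x \<in> R \<Longrightarrow> act w (- x) = - act w x"
  using act_add[of w x "- x"] by (simp add: R_uminus act_zero add_eq_0_iff)

lemma act_1: assumes w: "w \<in> carrier W" shows "act w 1 = 1"
proof -
  have inv: "act w (act (inv w) 1) = 1"
    using act_comp[of w "inv w" 1] w by simp
  have "act w (act (inv w) 1 * 1) = act w (act (inv w) 1) * act w 1"
    using w by (intro act_mult) (auto intro: act_R)
  then show ?thesis by (simp add: inv)
qed

lemma act_reflection_pow:
  assumes "p \<in> T" "x \<in> R"
  shows "act (p [^] (k::nat)) x = (if even k then x else act p x)"
proof -
  have "p [^] (k::nat) = (if even k then \<one> else p)"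
    using reflection_square[OF assms(1)] T_carrier[OF assms(1)] by (induction k) auto
  then show ?thesis using assms(2) by simp
qed

definition rt_ideal :: "'w \<Rightarrow> nat \<Rightarrow> 'r set" where
  "rt_ideal p k = {rt p ^ k * r | r. r \<in> R}"

lemma rt_ideal_0 [simp]: "rt_ideal p 0 = R"
  by (simp add: rt_ideal_def)

lemma rt_ideal_add: "x \<in> rt_ideal p k \<Longrightarrow> y \<in> rt_ideal p k \<Longrightarrow> x + y \<in> rt_ideal p k"
  unfolding rt_ideal_def by (auto simp flip: distrib_left intro: R_add)

lemma rt_ideal_mult: "x \<in> rt_ideal p j \<Longrightarrow> y \<in> rt_ideal p k \<Longrightarrow> x * y \<in> rt_ideal p (j + k)"
  unfolding rt_ideal_def
proof clarify
  fix r s assume "r \<in> R" "s \<in> R"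
  then show "\<exists>u. rt p ^ j * r * (rt p ^ k * s) = rt p ^ (j + k) * u \<and> u \<in> R"
    by (intro exI[of _ "r * s"]) (simp add: R_mult power_add)
qed

lemma rt_ideal_cmult: "c \<in> R \<Longrightarrow> y \<in> rt_ideal p k \<Longrightarrow> c * y \<in> rt_ideal p k"
  using rt_ideal_mult[of c p 0 y k] by simp

lemma rt_ideal_diff: "x \<in> rt_ideal p k \<Longrightarrow> y \<in> rt_ideal p k \<Longrightarrow> x - y \<in> rt_ideal p k"
  unfolding rt_ideal_def by (auto simp flip: right_diff_distrib intro: R_diff)

lemma rt_ideal_coprime:
  assumes "p \<in> T" "q \<in> T" "p \<noteq> q"
  shows "x \<in> R \<Longrightarrow> rt q * x \<in> rt_ideal p k \<Longrightarrow> x \<in> rt_ideal p k"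
proof (induction k arbitrary: x)
  case (Suc k)
  then obtain r where r: "r \<in> R" "rt q * x = rt p * (rt p ^ k * r)"
    by (auto simp: rt_ideal_def mult_ac)
  then obtain z where z: "z \<in> R" "x = rt p * z"
    using rt_coprime[OF assms Suc.prems(1) _ r(2)] assms by (auto intro!: R_mult R_power rt_R)
  have "rt p * (rt q * z) = rt p * (rt p ^ k * r)" using r(2) z(2) by (simp add: mult_ac)
  then have "rt q * z = rt p ^ k * r" using rt_nonzero[OF assms(1)] by simp
  then have "z \<in> rt_ideal p k" using Suc.IH[OF z(1)] r(1) by (auto simp: rt_ideal_def)
  then show ?case by (auto simp: z(2) rt_ideal_def mult_ac)
qed simp

lemma reflection_diff_ideal: "p \<in> T \<Longrightarrow> x \<in> R \<Longrightarrow> x - act p x \<in> rt_ideal p 1"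
  using reflection_diff[of p x] by (auto simp: rt_ideal_def)

subsection \<open>Flipping subexpressions\<close>

lemma expr: "set t \<subseteq> T \<Longrightarrow> reflection_expression W R act t"
  using T_carrier by unfold_locales blast

lemma prefix_closed: "set t \<subseteq> T \<Longrightarrow> i \<le> length t \<Longrightarrow> prefix_prod W t \<epsilon> i \<in> carrier W"
  using reflection_expression.prefix_prod_closed[OF expr] by blast

lemma sub_refl_T: "set t \<subseteq> T \<Longrightarrow> i < length t \<Longrightarrow> sub_refl W t \<epsilon> i \<in> T"
  unfolding sub_refl_def by (intro conj_T prefix_closed) (auto dest: nth_mem)

text \<open>
  At a position \<open>i\<close> of \<open>Y\<close> the entry \<open>t ! i\<close> is inserted or removed behind the partial product \<open>u\<close>.  As
  \<open>u (t ! i) = p u\<close>, either change amounts to one more factor \<open>p\<close> in front.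
\<close>

lemma prefix_prod_flip:
  assumes t: "set t \<subseteq> T" and p: "p \<in> T" and \<epsilon>: "\<epsilon> \<in> Sub t" and Y: "Y \<subseteq> positions W t \<epsilon> p"
    and "i \<le> length t"
  shows "prefix_prod W t (flip Y \<epsilon>) i = p [^] card (Y \<inter> {..<i}) \<otimes> prefix_prod W t \<epsilon> i"
  using \<open>i \<le> length t\<close>
proof (induction i)
  case 0
  then show ?case by (simp add: prefix_prod_def list_prod_def)
next
  case (Suc i)
  interpret t: reflection_expression W R act t by (rule expr[OF t])
  let ?k = "card (Y \<inter> {..<i})"
  define u where "u = prefix_prod W t \<epsilon> i"
  have i: "i < length t" "i < length \<epsilon>" using Suc.prems \<epsilon> by (auto simp: Sub_def)
  have u: "u \<in> carrier W" unfolding u_def using i t by (intro prefix_closed) auto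
  have ti: "t ! i \<in> T" using t i by auto
  have cl: "t ! i \<in> carrier W" "p \<in> carrier W" "p [^] ?k \<in> carrier W"
    using T_carrier ti p by auto
  have IH: "prefix_prod W t (flip Y \<epsilon>) i = p [^] ?k \<otimes> u" using Suc unfolding u_def by simp
  show ?case
  proof (cases "i \<in> Y")
    case False
    then have "Y \<inter> {..<Suc i} = Y \<inter> {..<i}" by (auto simp: less_Suc_eq)
    then show ?thesis
      using False i u cl
      by (simp add: t.prefix_prod_Suc IH nth_flip W.m_assoc flip: u_def)
  next
    case True
    then have "Y \<inter> {..<Suc i} = insert i (Y \<inter> {..<i})" by (auto simp: less_Suc_eq)
    then have card: "card (Y \<inter> {..<Suc i}) = Suc ?k" by simp
    have "u \<otimes> t ! i \<otimes> inv u = p"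
      using True Y by (auto simp: positions_def sub_refl_def u_def)
    then have pu: "p \<otimes> u = u \<otimes> t ! i"
      using u cl by (metis W.inv_solve_right W.m_closed)
    have ppu: "p \<otimes> (u \<otimes> t ! i) = u"
      using u cl reflection_square[OF p] by (simp flip: pu W.m_assoc)
    show ?thesis
      using True i u cl
      by (simp add: t.prefix_prod_Suc IH nth_flip card W.m_assoc pu ppu flip: u_def)
  qed
qed

text \<open>
  By \<open>prefix_prod_flip\<close> each \<open>sub_refl W t \<epsilon> i\<close> is conjugated by a power of \<open>p\<close>, which centralizes \<open>p\<close>.
\<close>

lemma positions_flip:
  assumes t: "set t \<subseteq> T" and p: "p \<in> T" and \<epsilon>: "\<epsilon> \<in> Sub t" and Y: "Y \<subseteq> positions W t \<epsilon> p"
  shows "positions W t (flip Y \<epsilon>) p = positions W t \<epsilon> p"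
proof -
  have "sub_refl W t (flip Y \<epsilon>) i = p \<longleftrightarrow> sub_refl W t \<epsilon> i = p" if i: "i < length t" for i
  proof -
    define v where "v = p [^] card (Y \<inter> {..<i})"
    define u where "u = prefix_prod W t \<epsilon> i"
    have u: "u \<in> carrier W" unfolding u_def using i t by (intro prefix_closed) auto
    have "t ! i \<in> T" using t i by auto
    then have cl: "t ! i \<in> carrier W" "p \<in> carrier W" using T_carrier p by auto
    have v: "v \<in> carrier W" "v \<otimes> p = p \<otimes> v"
      using cl W.nat_pow_comm[of p "card (Y \<inter> {..<i})" 1] unfolding v_def by auto
    have "sub_refl W t (flip Y \<epsilon>) i = v \<otimes> sub_refl W t \<epsilon> i \<otimes> inv v"
      using prefix_prod_flip[OF assms, of i] i u v(1) cl
      by (simp add: sub_refl_def W.m_assoc W.inv_mult_group flip: u_def v_def)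
    moreover have "v \<otimes> q \<otimes> inv v = p \<longleftrightarrow> q = p" if "q \<in> carrier W" for q
      using that v cl by (metis W.inv_solve_right W.Units_l_cancel W.Units_eq W.m_closed)
    ultimately show ?thesis using sub_refl_T[OF t i] T_carrier by metis
  qed
  then show ?thesis by (auto simp: positions_def)
qed

lemma finite_positions: "finite (positions W t \<epsilon> p)"
  by (simp add: positions_def)

lemma prefix_prod_snoc:
  assumes "\<epsilon> \<in> Sub t" "i \<le> length t"
  shows "prefix_prod W (t @ [x]) (\<epsilon> @ [b]) i = prefix_prod W t \<epsilon> i"
  unfolding prefix_prod_def using assms
  by (intro arg_cong[where f = "list_prod W"]) (auto simp: Sub_def nth_append)

lemma prefix_prod_snoc_last:
  assumes "set t \<subseteq> T" "x \<in> T" "\<epsilon> \<in> Sub t"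
  shows "prefix_prod W (t @ [x]) (\<epsilon> @ [b]) (Suc (length t))
    = prefix_prod W t \<epsilon> (length t) \<otimes> (if b then x else \<one>)"
proof -
  interpret tx: reflection_expression W R act "t @ [x]" using assms by (intro expr) simp
  show ?thesis using tx.prefix_prod_Suc[of "length t" "\<epsilon> @ [b]"] assms
    by (simp add: prefix_prod_snoc Sub_def nth_append)
qed

lemma sub_refl_snoc:
  assumes "\<epsilon> \<in> Sub t" "i < length t"
  shows "sub_refl W (t @ [x]) (\<epsilon> @ [b]) i = sub_refl W t \<epsilon> i"
  using assms by (simp add: sub_refl_def prefix_prod_snoc nth_append)

lemma sub_refl_snoc_last:
  assumes "\<epsilon> \<in> Sub t"
  shows "sub_refl W (t @ [x]) (\<epsilon> @ [b]) (length t)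
    = prefix_prod W t \<epsilon> (length t) \<otimes> x \<otimes> inv (prefix_prod W t \<epsilon> (length t))"
  using assms by (simp add: sub_refl_def prefix_prod_snoc)

lemma positions_snoc:
  assumes "\<epsilon> \<in> Sub t"
  shows "positions W (t @ [x]) (\<epsilon> @ [b]) p = positions W t \<epsilon> p \<union>
    (if sub_refl W (t @ [x]) (\<epsilon> @ [b]) (length t) = p then {length t} else {})"
  using assms by (auto simp: positions_def sub_refl_snoc less_Suc_eq)

subsection \<open>Local functions\<close>

definition is_local :: "'w list \<Rightarrow> (bool list \<Rightarrow> 'r) \<Rightarrow> bool" where
  "is_local t g \<longleftrightarrow> (\<forall>\<epsilon>\<in>Sub t. g \<epsilon> \<in> R) \<and>
     (\<forall>p\<in>T. \<forall>\<epsilon>\<in>Sub t. \<forall>X\<subseteq>positions W t \<epsilon> p. alt_sum \<epsilon> X g \<in> rt_ideal p (card X))"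

lemma local_functions_iff:
  "g \<in> local_functions W S R rt t \<longleftrightarrow> g \<in> extensional (Sub t) \<and> is_local t g"
  by (auto simp: local_functions_def is_local_def rt_ideal_def fun_ring_def PiE_iff)

lemma is_localD:
  assumes "is_local t g"
  shows "\<epsilon> \<in> Sub t \<Longrightarrow> g \<epsilon> \<in> R"
    and "\<lbrakk>p \<in> T; \<epsilon> \<in> Sub t; X \<subseteq> positions W t \<epsilon> p\<rbrakk> \<Longrightarrow> alt_sum \<epsilon> X g \<in> rt_ideal p (card X)"
  using assms by (auto simp: is_local_def)

lemma is_local_cong:
  "(\<And>\<epsilon>. \<epsilon> \<in> Sub t \<Longrightarrow> f \<epsilon> = g \<epsilon>) \<Longrightarrow> is_local t f \<longleftrightarrow> is_local t g"
  using alt_sum_cong[of _ t f g] by (simp add: is_local_def cong: ball_cong)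

lemma is_local_diff: "is_local t f \<Longrightarrow> is_local t g \<Longrightarrow> is_local t (\<lambda>\<epsilon>. f \<epsilon> - g \<epsilon>)"
  by (simp add: is_local_def alt_sum_diff rt_ideal_diff R_diff)

lemma is_local_add: "is_local t f \<Longrightarrow> is_local t g \<Longrightarrow> is_local t (\<lambda>\<epsilon>. f \<epsilon> + g \<epsilon>)"
  by (simp add: is_local_def alt_sum_add rt_ideal_add R_add)

lemma is_local_cmult: "is_local t f \<Longrightarrow> c \<in> R \<Longrightarrow> is_local t (\<lambda>\<epsilon>. c * f \<epsilon>)"
  by (simp add: is_local_def alt_sum_cmult rt_ideal_cmult R_mult)

lemma is_local_zero: "is_local t (\<lambda>\<epsilon>. 0)"
  by (auto simp: is_local_def alt_sum_def rt_ideal_def)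

lemma is_local_restrict: "is_local t (restrict f (Sub t)) \<longleftrightarrow> is_local t f"
  by (rule is_local_cong) simp

text \<open>
  Only one power of the root is lost: the twisted sum splits into two alternating sums over \<open>X\<close>
  without its maximum.
\<close>

lemma twisted_sum_local:
  assumes t: "set t \<subseteq> T" and g: "is_local t g" and p: "p \<in> T" and \<epsilon>: "\<epsilon> \<in> Sub t"
    and X: "X \<subseteq> positions W t \<epsilon> p"
  shows "twisted_sum \<epsilon> X g \<in> rt_ideal p (card X - 1)"
proof (cases "X = {}")
  case True
  then show ?thesis using is_localD(1)[OF g \<epsilon>] by (simp add: twisted_sum_def)
next
  case False
  have fin: "finite X" using X finite_positions finite_subset by blast
  define m where "m = Max X"
  define X' where "X' = X - {m}"
  have m: "m \<in> X" using fin False by (simp add: m_def)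
  then have X'_eq: "X = insert m X'" by (auto simp: X'_def)
  have X': "finite X'" "m \<notin> X'" using fin by (auto simp: X'_def)
  have less: "x < m" if "x \<in> X'" for x
    using that Max_ge[OF fin, of x] by (auto simp: X'_def m_def)
  have pos: "X' \<subseteq> positions W t \<epsilon> p" "X' \<subseteq> positions W t (flip {m} \<epsilon>) p"
    using X m positions_flip[OF t p \<epsilon>, of "{m}"] by (auto simp: X'_def)
  have "twisted_sum \<epsilon> X g = alt_sum \<epsilon> X' g + alt_sum (flip {m} \<epsilon>) X' g"
    unfolding X'_eq by (rule twisted_sum_insert_max[OF X'(1) less])
  also have "\<dots> \<in> rt_ideal p (card X')"
    using g p \<epsilon> pos by (intro rt_ideal_add is_localD(2)) auto
  finally show ?thesis using X' by (simp add: X'_eq)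
qed

text \<open>
  The core estimate.  The mean of \<open>c\<^sub>0\<close> and \<open>c\<^sub>1\<close> multiplies the alternating sum and half their
  difference multiplies the twisted one; the power of the root missing there is supplied by
  \<open>c\<^sub>0 - c\<^sub>1\<close>.
\<close>

lemma alt_sum_parity_weights:
  assumes t: "set t \<subseteq> T" and g: "is_local t g" and p: "p \<in> T" and \<epsilon>: "\<epsilon> \<in> Sub t"
    and X: "X \<subseteq> positions W t \<epsilon> p"
    and c: "c\<^sub>0 \<in> R" "c\<^sub>1 \<in> R" "c\<^sub>0 - c\<^sub>1 \<in> rt_ideal p 1"
  shows "(\<Sum>Y\<in>Pow X. (- 1) ^ odd_count X Y * (g (flip Y \<epsilon>) * (if even (card Y) then c\<^sub>0 else c\<^sub>1)))
    \<in> rt_ideal p (card X)"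
proof (cases "X = {}")
  case True
  then show ?thesis using is_localD(1)[OF g \<epsilon>] c by (simp add: R_mult)
next
  case False
  have fin: "finite X" using X finite_positions finite_subset by blast
  define a where "a = inverse 2 * (c\<^sub>0 + c\<^sub>1)"
  define b where "b = inverse 2 * (c\<^sub>0 - c\<^sub>1)"
  have half: "inverse 2 * z + inverse 2 * z = z" for z :: 'r
    using two_nonzero by (simp add: field_simps)
  have "a + b = c\<^sub>0" "a - b = c\<^sub>1"
    unfolding a_def b_def using half[of c\<^sub>0] half[of c\<^sub>1] by (simp_all only: distrib_left right_diff_distrib) (simp_all add: algebra_simps del: left_inverse)
  then have weight: "(if even (card Y) then c\<^sub>0 else c\<^sub>1) = a + (- 1) ^ card Y * b" for Y :: "nat set"
    by (cases "even (card Y)") simp_all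
  have "(\<Sum>Y\<in>Pow X. (- 1) ^ odd_count X Y * (g (flip Y \<epsilon>) * (if even (card Y) then c\<^sub>0 else c\<^sub>1)))
      = a * alt_sum \<epsilon> X g + b * twisted_sum \<epsilon> X g"
    unfolding alt_sum_def twisted_sum_def sum_distrib_left sum.distrib[symmetric]
    unfolding weight power_add by (intro sum.cong HOL.refl) (simp add: algebra_simps)
  also have "\<dots> \<in> rt_ideal p (card X)"
  proof (rule rt_ideal_add)
    show "a * alt_sum \<epsilon> X g \<in> rt_ideal p (card X)"
      unfolding a_def using assms by (intro rt_ideal_cmult is_localD(2) R_mult R_add half_R) auto
    have "b * twisted_sum \<epsilon> X g \<in> rt_ideal p (1 + (card X - 1))"
      unfolding b_def using assms by (intro rt_ideal_mult rt_ideal_cmult half_R twisted_sum_local) auto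
    moreover have "1 + (card X - 1) = card X" using False fin by (simp add: card_gt_0_iff Suc_leI)
    ultimately show "b * twisted_sum \<epsilon> X g \<in> rt_ideal p (card X)" by simp
  qed
  finally show ?thesis .
qed

subsection \<open>Appending a reflection\<close>

text \<open>
  The effect on localized functions of appending a tensor factor \<open>a\<close>; see \<open>loc_append_tuple\<close>.
\<close>

definition loc_append :: "'w list \<Rightarrow> 'w \<Rightarrow> 'r \<Rightarrow> (bool list \<Rightarrow> 'r) \<Rightarrow> bool list \<Rightarrow> 'r" where
  "loc_append t x a f =
     (\<lambda>\<eta>\<in>Sub (t @ [x]). f (butlast \<eta>) * act (prefix_prod W (t @ [x]) \<eta> (Suc (length t))) a)"

lemma loc_append_snoc:
  assumes "\<epsilon> \<in> Sub t"
  shows "loc_append t x a f (\<epsilon> @ [b])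
    = f \<epsilon> * act (prefix_prod W (t @ [x]) (\<epsilon> @ [b]) (Suc (length t))) a"
  using assms by (simp add: loc_append_def Sub_def)

text \<open>
  If \<open>X\<close> avoids the last position, \<open>a\<close> contributes a weight that depends on the parity of the flipped
  set.  If \<open>X\<close> contains it, the weights of a subset with and without the last position differ by
  one application of \<open>p\<close>, so their difference is, up to the twisting sign, a constant multiple of the
  root of \<open>p\<close>, and an alternating sum of \<open>h\<close> remains.
\<close>

lemma is_local_append:
  assumes t: "set t \<subseteq> T" and x: "x \<in> T" and a: "a \<in> R" and h: "is_local t h"
  shows "is_local (t @ [x]) (loc_append t x a h)"
  unfolding is_local_def
proof (intro conjI ballI allI impI)
  have tx: "set (t @ [x]) \<subseteq> T" using t x by simp
  define w where "w \<eta> = act (prefix_prod W (t @ [x]) \<eta> (Suc (length t))) a" for \<eta>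
  have w_R: "w \<eta> \<in> R" for \<eta> unfolding w_def using a by (intro act_R prefix_closed[OF tx]) auto
  have g: "loc_append t x a h (\<epsilon> @ [b]) = h \<epsilon> * w (\<epsilon> @ [b])" if "\<epsilon> \<in> Sub t" for \<epsilon> b
    using loc_append_snoc[OF that] by (simp add: w_def)
  show "loc_append t x a h \<eta> \<in> R" if "\<eta> \<in> Sub (t @ [x])" for \<eta>
    using that is_localD(1)[OF h] w_R by (auto simp: Sub_snoc g R_mult)
  fix p \<eta> X assume p: "p \<in> T" and \<eta>: "\<eta> \<in> Sub (t @ [x])"
    and X: "X \<subseteq> positions W (t @ [x]) \<eta> p"
  obtain \<epsilon> b where \<epsilon>: "\<epsilon> \<in> Sub t" "\<eta> = \<epsilon> @ [b]" using \<eta> by (auto simp: Sub_snoc)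
  have len: "length \<epsilon> = length t" using \<epsilon> by (simp add: Sub_def)
  have w_flip: "w (flip Y \<eta>) = (if even (card Y) then w \<eta> else act p (w \<eta>))" if "Y \<subseteq> X" for Y
  proof -
    have Y: "Y \<subseteq> positions W (t @ [x]) \<eta> p" using that X by blast
    then have "Y \<inter> {..<Suc (length t)} = Y" by (auto simp: positions_def)
    then have "w (flip Y \<eta>) = act (p [^] card Y) (w \<eta>)"
      unfolding w_def using prefix_prod_flip[OF tx p \<eta> Y, of "Suc (length t)"] T_carrier[OF p] a
      by (simp add: act_comp prefix_closed[OF tx])
    then show ?thesis using act_reflection_pow[OF p w_R] by simp
  qed
  have pw: "act p (w \<eta>) \<in> R" using act_R[OF T_carrier[OF p] w_R] .
  \<comment> \<open>The part of \<open>X\<close> that consists of positions of \<open>t\<close>.\<close>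
  define X' where "X' = X - {length t}"
  have X': "X' \<subseteq> X" "X' \<subseteq> positions W t \<epsilon> p"
    using X positions_snoc[OF \<epsilon>(1), of x b p] by (auto simp: X'_def \<epsilon>(2) split: if_splits)
  have less: "i < length t" if "i \<in> X'" for i
    using X'(2) that by (auto simp: positions_def)
  have fin: "finite X'" using X'(2) finite_positions finite_subset by blast
  have sub: "Y \<subseteq> {..<length \<epsilon>}" if "Y \<subseteq> X'" for Y using that less len by auto
  have g_flip: "loc_append t x a h (flip Y \<eta>) = h (flip Y \<epsilon>) * w (flip Y \<eta>)" if "Y \<subseteq> X'" for Y
    using sub[OF that] \<epsilon> by (simp add: flip_snoc g)
  show "alt_sum \<eta> X (loc_append t x a h) \<in> rt_ideal p (card X)"
  proof (cases "length t \<in> X")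
    case False
    then have X_eq: "X = X'" by (simp add: X'_def)
    have "alt_sum \<eta> X (loc_append t x a h) = (\<Sum>Y\<in>Pow X'. (- 1) ^ odd_count X' Y
        * (h (flip Y \<epsilon>) * (if even (card Y) then w \<eta> else act p (w \<eta>))))"
      unfolding alt_sum_def X_eq using X' by (intro sum.cong) (auto simp: g_flip w_flip)
    then show ?thesis
      using alt_sum_parity_weights[OF t h p \<epsilon>(1) X'(2) w_R pw reflection_diff_ideal[OF p w_R]]
      by (simp add: X_eq)
  next
    case True
    then have X_eq: "X = insert (length t) X'" by (auto simp: X'_def)
    have "alt_sum \<eta> X (loc_append t x a h) = (\<Sum>Y\<in>Pow X'. (- 1) ^ (card Y + odd_count X' Y)
      * (loc_append t x a h (flip Y \<eta>) - loc_append t x a h (flip (insert (length t) Y) \<eta>)))"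
      unfolding X_eq by (rule alt_sum_insert_max[OF fin less])
    also have "\<dots> = (\<Sum>Y\<in>Pow X'. (w \<eta> - act p (w \<eta>)) * ((- 1) ^ odd_count X' Y * h (flip Y \<epsilon>)))"
    proof (rule sum.cong[OF HOL.refl])
      fix Y assume "Y \<in> Pow X'"
      then have Y: "Y \<subseteq> X'" "Y \<subseteq> X" "insert (length t) Y \<subseteq> X" using X'(1) True by auto
      have "finite Y" "length t \<notin> Y" using Y(1) fin finite_subset by (auto simp: X'_def)
      then have card: "card (insert (length t) Y) = Suc (card Y)" by simp
      have "flip (insert (length t) Y) \<eta> = flip Y \<epsilon> @ [\<not> b]"
        using flip_insert_snoc[OF sub[OF Y(1)]] by (simp add: len \<epsilon>(2))
      then have "loc_append t x a h (flip (insert (length t) Y) \<eta>)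
          = h (flip Y \<epsilon>) * w (flip (insert (length t) Y) \<eta>)"
        using \<epsilon>(1) by (simp add: g)
      then show "(- 1) ^ (card Y + odd_count X' Y)
          * (loc_append t x a h (flip Y \<eta>) - loc_append t x a h (flip (insert (length t) Y) \<eta>))
        = (w \<eta> - act p (w \<eta>)) * ((- 1) ^ odd_count X' Y * h (flip Y \<epsilon>))"
        using Y(1) by (simp add: g_flip w_flip[OF Y(2)] w_flip[OF Y(3)] card power_add)
          (simp add: algebra_simps)
    qed
    also have "\<dots> = (w \<eta> - act p (w \<eta>)) * alt_sum \<epsilon> X' h"
      by (simp add: alt_sum_def sum_distrib_left)
    also have "\<dots> \<in> rt_ideal p (1 + card X')"
      by (intro rt_ideal_mult reflection_diff_ideal is_localD(2)[OF h] p \<epsilon> X' w_R)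
    finally show ?thesis using fin less unfolding X_eq by (subst card_insert_disjoint) auto
  qed
qed

text \<open>
  The converse of \<open>is_local_append\<close>, for the basis \<open>1, rt x\<close> of \<open>R\<close> over the \<open>x\<close>-invariants: the
  components \<open>h\<^sub>0\<close> and \<open>h\<^sub>1\<close> are forced, and the congruences of \<open>g\<close> show first that \<open>h\<^sub>1\<close> has values in
  \<open>R\<close> and then that it is local.
\<close>

lemma is_local_snoc_decompose:
  assumes t: "set t \<subseteq> T" and x: "x \<in> T" and g: "is_local (t @ [x]) g"
  obtains h\<^sub>0 h\<^sub>1 where "is_local t h\<^sub>0" "is_local t h\<^sub>1"
    "\<And>\<eta>. \<eta> \<in> Sub (t @ [x]) \<Longrightarrow> g \<eta> = loc_append t x 1 h\<^sub>0 \<eta> + loc_append t x (rt x) h\<^sub>1 \<eta>"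
proof
  have xW: "x \<in> carrier W" using T_carrier x .
  define u where "u \<epsilon> = prefix_prod W t \<epsilon> (length t)" for \<epsilon>
  define \<beta> where "\<beta> \<epsilon> = act (u \<epsilon>) (rt x)" for \<epsilon>
  define q where "q \<epsilon> = u \<epsilon> \<otimes> x \<otimes> inv u \<epsilon>" for \<epsilon>
  define d where "d = (\<lambda>\<epsilon>. inverse 2 * (g (\<epsilon> @ [False]) - g (\<epsilon> @ [True])))"
  define h\<^sub>0 where "h\<^sub>0 = (\<lambda>\<epsilon>. inverse 2 * (g (\<epsilon> @ [False]) + g (\<epsilon> @ [True])))"
  define h\<^sub>1 where "h\<^sub>1 = (\<lambda>\<epsilon>. d \<epsilon> / \<beta> \<epsilon>)"
  have u: "u \<epsilon> \<in> carrier W" for \<epsilon> unfolding u_def by (intro prefix_closed t) simp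
  have q: "q \<epsilon> \<in> T" for \<epsilon> unfolding q_def by (intro conj_T u x)
  have \<beta>_R: "\<beta> \<epsilon> \<in> R" for \<epsilon> unfolding \<beta>_def by (intro act_R u rt_R x)
  have unit: "\<exists>c. c \<in> R \<and> inverse c \<in> R \<and> c \<noteq> 0 \<and> \<beta> \<epsilon> = c * rt (q \<epsilon>)" for \<epsilon>
    unfolding \<beta>_def q_def by (rule act_rt[OF u x])
  have \<beta>_nonzero: "\<beta> \<epsilon> \<noteq> 0" for \<epsilon> using unit[of \<epsilon>] rt_nonzero[OF q[of \<epsilon>]] by auto
  have half: "inverse 2 * z + inverse 2 * z = z" for z :: 'r
    using two_nonzero by (simp add: field_simps)
  have slice: "is_local t (\<lambda>\<epsilon>. g (\<epsilon> @ [b]))" for b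
    unfolding is_local_def
  proof (intro conjI ballI allI impI)
    show "g (\<epsilon> @ [b]) \<in> R" if "\<epsilon> \<in> Sub t" for \<epsilon>
      using is_localD(1)[OF g] that by (auto simp: Sub_snoc)
    fix p \<epsilon> X assume *: "p \<in> T" "\<epsilon> \<in> Sub t" "X \<subseteq> positions W t \<epsilon> p"
    then have "X \<subseteq> {..<length \<epsilon>}" by (auto simp: positions_def Sub_def)
    then show "alt_sum \<epsilon> X (\<lambda>\<epsilon>. g (\<epsilon> @ [b])) \<in> rt_ideal p (card X)"
      using * is_localD(2)[OF g, of p "\<epsilon> @ [b]" X]
      by (auto simp: alt_sum_snoc Sub_snoc positions_snoc)
  qed
  have d: "is_local t d"
    unfolding d_def by (intro is_local_cmult is_local_diff slice half_R)
  show "is_local t h\<^sub>0"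
    unfolding h\<^sub>0_def by (intro is_local_cmult is_local_add slice half_R)
  \<comment> \<open>The last position carries the reflection \<open>q \<epsilon>\<close>.  If this is \<open>p\<close>, the position may be added to \<open>X\<close>,
    and the condition of \<open>g\<close> for the larger set is a condition on the difference of the slices.\<close>
  have twisted: "twisted_sum \<epsilon> X d \<in> rt_ideal p (Suc (card X))"
    if \<epsilon>: "\<epsilon> \<in> Sub t" and p: "p \<in> T" "q \<epsilon> = p" and X: "X \<subseteq> positions W t \<epsilon> p" for \<epsilon> p X
  proof -
    let ?n = "length t" and ?\<eta> = "\<epsilon> @ [False]"
    have len: "length \<epsilon> = length t" using \<epsilon> by (simp add: Sub_def)
    have fin: "finite X" using X finite_positions finite_subset by blast
    have less: "i < ?n" if "i \<in> X" for i using that X by (auto simp: positions_def)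
    have "insert ?n X \<subseteq> positions W (t @ [x]) ?\<eta> p"
      using \<epsilon> X p(2) by (auto simp: positions_snoc sub_refl_snoc_last q_def u_def)
    then have "alt_sum ?\<eta> (insert ?n X) g \<in> rt_ideal p (card (insert ?n X))"
      using \<epsilon> p(1) by (intro is_localD(2)[OF g]) (auto simp: Sub_snoc)
    moreover have "card (insert ?n X) = Suc (card X)"
      using fin less by (intro card_insert_disjoint) auto
    moreover have "twisted_sum \<epsilon> X d = inverse 2 * alt_sum ?\<eta> (insert ?n X) g"
    proof -
      have "flip Y ?\<eta> = flip Y \<epsilon> @ [False]" "flip (insert ?n Y) ?\<eta> = flip Y \<epsilon> @ [True]"
        if "Y \<subseteq> X" for Y
      proof -
        have "Y \<subseteq> {..<length \<epsilon>}" using that less len by auto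
        then show "flip Y ?\<eta> = flip Y \<epsilon> @ [False]" "flip (insert ?n Y) ?\<eta> = flip Y \<epsilon> @ [True]"
          using flip_insert_snoc[of Y \<epsilon> False] by (simp_all add: flip_snoc len)
      qed
      note flips = this
      have split: "alt_sum ?\<eta> (insert ?n X) g = (\<Sum>Y\<in>Pow X. (- 1) ^ (card Y + odd_count X Y)
          * (g (flip Y ?\<eta>) - g (flip (insert ?n Y) ?\<eta>)))"
        by (rule alt_sum_insert_max[OF fin less])
      show ?thesis
        unfolding split twisted_sum_def d_def sum_distrib_left
        by (intro sum.cong HOL.refl) (simp add: flips mult.left_commute)
    qed
    ultimately show ?thesis by (simp only: rt_ideal_cmult half_R)
  qed
  have \<beta>_cancel: "z / \<beta> \<epsilon> \<in> rt_ideal (q \<epsilon>) k" if z: "z \<in> rt_ideal (q \<epsilon>) (Suc k)" for z \<epsilon> k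
  proof -
    obtain c where c: "c \<in> R" "inverse c \<in> R" "c \<noteq> 0" "\<beta> \<epsilon> = c * rt (q \<epsilon>)"
      using unit[of \<epsilon>] by blast
    obtain r where r: "r \<in> R" "z = rt (q \<epsilon>) ^ Suc k * r" using z by (auto simp: rt_ideal_def)
    have "z / \<beta> \<epsilon> = rt (q \<epsilon>) ^ k * (inverse c * r)"
      using c(3) rt_nonzero[OF q[of \<epsilon>]] by (simp add: r c(4) field_simps)
    then show ?thesis using c(2) r(1) by (auto simp: rt_ideal_def intro: R_mult)
  qed
  have h\<^sub>1_R: "h\<^sub>1 \<epsilon> \<in> R" if "\<epsilon> \<in> Sub t" for \<epsilon>
    using \<beta>_cancel[of "d \<epsilon>" \<epsilon> 0] twisted[OF that q HOL.refl, of "{}"]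
    by (simp add: h\<^sub>1_def twisted_sum_def)
  have \<beta>_flip: "\<beta> (flip Y \<epsilon>) = (if even (card Y) then \<beta> \<epsilon> else act p (\<beta> \<epsilon>))"
    if "p \<in> T" "\<epsilon> \<in> Sub t" "Y \<subseteq> positions W t \<epsilon> p" for p \<epsilon> Y
  proof -
    have "Y \<inter> {..<length t} = Y" using that(3) by (auto simp: positions_def)
    then have "u (flip Y \<epsilon>) = p [^] card Y \<otimes> u \<epsilon>"
      unfolding u_def using prefix_prod_flip[OF t that, of "length t"] by simp
    then have "\<beta> (flip Y \<epsilon>) = act (p [^] card Y) (\<beta> \<epsilon>)"
      unfolding \<beta>_def using T_carrier[OF that(1)] u x by (simp add: act_comp rt_R)
    then show ?thesis using act_reflection_pow[OF that(1) \<beta>_R] by simp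
  qed
  show "is_local t h\<^sub>1"
    unfolding is_local_def
  proof (intro conjI ballI allI impI h\<^sub>1_R)
    fix p \<epsilon> X assume p: "p \<in> T" and \<epsilon>: "\<epsilon> \<in> Sub t" and X: "X \<subseteq> positions W t \<epsilon> p"
    have pW: "p \<in> carrier W" using T_carrier[OF p] .
    have sub: "Y \<subseteq> positions W t \<epsilon> p" if "Y \<subseteq> X" for Y using that X by blast
    show "alt_sum \<epsilon> X h\<^sub>1 \<in> rt_ideal p (card X)"
    proof (cases "q \<epsilon> = p")
      case True
      \<comment> \<open>Here \<open>\<beta>\<close> is an eigenvector of \<open>p\<close>, and the signs of its values twist the sum.\<close>
      have pu: "p \<otimes> u \<epsilon> = u \<epsilon> \<otimes> x"
        unfolding True[symmetric] q_def using u[of \<epsilon>] xW by (simp add: W.m_assoc)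
      have "act p (\<beta> \<epsilon>) = act (u \<epsilon>) (act x (rt x))"
        unfolding \<beta>_def using u[of \<epsilon>] xW pW x by (simp add: pu rt_R flip: act_comp)
      then have "act p (\<beta> \<epsilon>) = - \<beta> \<epsilon>"
        using u[of \<epsilon>] x by (simp add: \<beta>_def act_rt_self act_uminus rt_R)
      then have "\<beta> (flip Y \<epsilon>) = (- 1) ^ card Y * \<beta> \<epsilon>" if "Y \<subseteq> X" for Y
        using \<beta>_flip[OF p \<epsilon> sub[OF that]] by (simp add: minus_one_power_iff)
      moreover have "z / ((- 1) ^ k * b) = (- 1) ^ k * (z / b)" for z b :: 'r and k
        by (cases "even k") (simp_all add: minus_one_power_iff)
      ultimately have "alt_sum \<epsilon> X h\<^sub>1 = twisted_sum \<epsilon> X d / \<beta> \<epsilon>"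
        unfolding alt_sum_def twisted_sum_def h\<^sub>1_def sum_divide_distrib
        by (intro sum.cong) (auto simp: power_add)
      then show ?thesis
        using twisted[OF \<epsilon> p True X] \<beta>_cancel[of _ \<epsilon> "card X"] by (simp add: True)
    next
      case False
      let ?b = "\<beta> \<epsilon>" and ?b' = "act p (\<beta> \<epsilon>)"
      have b': "?b' \<in> R" by (intro act_R pW \<beta>_R)
      obtain c where c: "c \<in> R" "inverse c \<in> R" "c \<noteq> 0" "?b = c * rt (q \<epsilon>)"
        using unit[of \<epsilon>] by blast
      define q' where "q' = p \<otimes> u \<epsilon> \<otimes> x \<otimes> inv (p \<otimes> u \<epsilon>)"
      have q': "q' \<in> T" unfolding q'_def by (intro conj_T W.m_closed pW u x)
      obtain c' where c': "c' \<in> R" "inverse c' \<in> R" "c' \<noteq> 0" "?b' = c' * rt q'"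
        using act_rt[of "p \<otimes> u \<epsilon>" x] pW u x unfolding q'_def
        by (auto simp: \<beta>_def act_comp rt_R)
      have "q' = p \<otimes> q \<epsilon> \<otimes> inv p"
        unfolding q'_def q_def using pW u xW by (simp add: W.m_assoc W.inv_mult_group)
      then have q'p: "q' \<noteq> p"
        using False pW T_carrier[OF q[of \<epsilon>]] by (metis W.inv_solve_right W.Units_l_cancel W.Units_eq W.m_closed)
      \<comment> \<open>Multiplication by both values of \<open>\<beta>\<close> clears the denominator and leaves the other value.\<close>
      have h\<^sub>1: "?b * (?b' * h\<^sub>1 (flip Y \<epsilon>)) = d (flip Y \<epsilon>) * (if even (card Y) then ?b' else ?b)"
        if "Y \<subseteq> X" for Y
        using \<beta>_flip[OF p \<epsilon> sub[OF that]] \<beta>_nonzero[of "flip Y \<epsilon>"] by (auto simp: h\<^sub>1_def)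
      define z where "z = alt_sum \<epsilon> X h\<^sub>1"
      have z: "z \<in> R"
        unfolding z_def alt_sum_def
        by (intro R_sum R_mult h\<^sub>1_R R_power R_uminus) (auto simp: \<epsilon>)
      have "?b * (?b' * z)
          = (\<Sum>Y\<in>Pow X. (- 1) ^ odd_count X Y * (?b * (?b' * h\<^sub>1 (flip Y \<epsilon>))))"
        unfolding z_def alt_sum_def sum_distrib_left by (simp add: mult_ac)
      also have "\<dots> = (\<Sum>Y\<in>Pow X. (- 1) ^ odd_count X Y
          * (d (flip Y \<epsilon>) * (if even (card Y) then ?b' else ?b)))"
        using h\<^sub>1 by (intro sum.cong) auto
      also have "\<dots> \<in> rt_ideal p (card X)"
      proof (rule alt_sum_parity_weights[OF t d p \<epsilon> X b' \<beta>_R])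
        have "(- 1) * (?b - ?b') \<in> rt_ideal p 1"
          by (intro rt_ideal_cmult reflection_diff_ideal p \<beta>_R R_uminus R_1)
        then show "?b' - ?b \<in> rt_ideal p 1" by simp
      qed
      finally have "inverse c * (inverse c' * (?b * (?b' * z))) \<in> rt_ideal p (card X)"
        by (rule rt_ideal_cmult[OF c(2) rt_ideal_cmult[OF c'(2)]])
      also have "inverse c * (inverse c' * (?b * (?b' * z))) = rt (q \<epsilon>) * (rt q' * z)"
        unfolding c'(4) unfolding c(4) using c(3) c'(3) by (simp add: field_simps)
      finally have qq': "rt (q \<epsilon>) * (rt q' * z) \<in> rt_ideal p (card X)" .
      have "rt q' * z \<in> rt_ideal p (card X)"
        using False by (intro rt_ideal_coprime[OF p q[of \<epsilon>] _ _ qq'] R_mult rt_R q' z) simp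
      then have "z \<in> rt_ideal p (card X)"
        using rt_ideal_coprime[OF p q' _ z] q'p by blast
      then show ?thesis by (simp only: z_def)
    qed
  qed
  show "g \<eta> = loc_append t x 1 h\<^sub>0 \<eta> + loc_append t x (rt x) h\<^sub>1 \<eta>" if "\<eta> \<in> Sub (t @ [x])" for \<eta>
  proof -
    obtain \<epsilon> b where \<epsilon>: "\<epsilon> \<in> Sub t" "\<eta> = \<epsilon> @ [b]" using \<open>\<eta> \<in> _\<close> by (auto simp: Sub_snoc)
    define w where "w = u \<epsilon> \<otimes> (if b then x else \<one>)"
    have w: "w \<in> carrier W" using u xW by (simp add: w_def)
    have "act w (rt x) = (if b then - \<beta> \<epsilon> else \<beta> \<epsilon>)"
      using u xW x by (simp add: w_def \<beta>_def act_comp rt_R act_rt_self act_uminus)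
    then have "loc_append t x 1 h\<^sub>0 \<eta> + loc_append t x (rt x) h\<^sub>1 \<eta>
        = h\<^sub>0 \<epsilon> + (if b then - d \<epsilon> else d \<epsilon>)"
      using \<epsilon> prefix_prod_snoc_last[OF t x \<epsilon>(1), of b] \<beta>_nonzero[of \<epsilon>] w
      by (simp add: loc_append_snoc act_1 h\<^sub>1_def flip: u_def w_def)
    also have "\<dots> = g \<eta>"
      using half[of "g \<eta>"] by (cases b) (simp_all add: h\<^sub>0_def d_def \<epsilon>(2) algebra_simps)
    finally show ?thesis ..
  qed
qed

subsection \<open>The image of the localization map\<close>

definition loc_image :: "'w list \<Rightarrow> (bool list \<Rightarrow> 'r) set" where
  "loc_image t = loc_free W act t ` {c. Poly_Mapping.keys c \<subseteq> tuples R (Suc (length t))}"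

text \<open>
  \<open>Loc\<close> is induced by \<open>loc_free\<close>, so its image can be studied on the free group of tuples, generated by
  the localizations of single tuples.
\<close>

lemma Loc_image:
  assumes "set t \<subseteq> T"
  shows "Loc W act t ` carrier (expr_ring R act t) = loc_image t"
proof -
  interpret t: reflection_expression W R act t by (rule expr[OF assms])
  have "carrier (expr_ring R act t) = (\<lambda>c. tensor_ideal R t.As +>\<^bsub>t.F\<^esub> c) ` carrier t.F"
    by (auto simp: expr_ring_def tensor_ring_def FactRing_def A_RCOSETS_def
        RCOSETS_def a_r_coset_def)
  then have "Loc W act t ` carrier (expr_ring R act t) = loc_free W act t ` carrier t.F"
    by (auto simp: image_image t.Loc_coset)
  then show ?thesis by (simp add: loc_image_def tuple_ring_def)
qed

lemma loc_image_induct [consumes 1, case_names zero pure diff]: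
  assumes "g \<in> loc_image t"
    and "P (\<lambda>\<epsilon>\<in>Sub t. 0)"
    and "\<And>xs. xs \<in> tuples R (Suc (length t)) \<Longrightarrow> P (\<lambda>\<epsilon>\<in>Sub t. loc_tuple W act t xs \<epsilon>)"
    and "\<And>f g. P f \<Longrightarrow> P g \<Longrightarrow> P (\<lambda>\<epsilon>\<in>Sub t. f \<epsilon> - g \<epsilon>)"
  shows "P g"
proof -
  obtain c where c: "Poly_Mapping.keys c \<subseteq> tuples R (Suc (length t))" "g = loc_free W act t c"
    using assms(1) by (auto simp: loc_image_def)
  from c(1) have "P (loc_free W act t c)"
  proof (induction c rule: frag_induction)
    case zero
    then show ?case using assms(2) by (simp add: loc_free_def restrict_def)
  next
    case (one xs)
    then show ?case unfolding loc_free_frag_of by (rule assms(3))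
  next
    case (diff a b)
    then show ?case unfolding loc_free_diff by (rule assms(4))
  qed
  then show ?thesis by (simp add: c(2))
qed

lemma loc_image_cong:
  assumes "restrict f (Sub t) \<in> loc_image t" "\<And>\<epsilon>. \<epsilon> \<in> Sub t \<Longrightarrow> f \<epsilon> = g \<epsilon>"
  shows "restrict g (Sub t) \<in> loc_image t"
proof -
  have "restrict f (Sub t) = restrict g (Sub t)" using assms(2) by (auto simp: restrict_def)
  then show ?thesis using assms(1) by simp
qed

lemma loc_image_zero: "(\<lambda>\<epsilon>\<in>Sub t. 0) \<in> loc_image t"
  unfolding loc_image_def by (rule image_eqI[where x = 0]) (simp_all add: loc_free_def restrict_def)

lemma loc_image_pure:
  "xs \<in> tuples R (Suc (length t)) \<Longrightarrow> (\<lambda>\<epsilon>\<in>Sub t. loc_tuple W act t xs \<epsilon>) \<in> loc_image t"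
  unfolding loc_image_def by (rule image_eqI[where x = "frag_of xs"]) (simp_all add: loc_free_frag_of)

lemma loc_image_diff:
  assumes "f \<in> loc_image t" "g \<in> loc_image t"
  shows "(\<lambda>\<epsilon>\<in>Sub t. f \<epsilon> - g \<epsilon>) \<in> loc_image t"
proof -
  obtain c d where cd: "Poly_Mapping.keys c \<subseteq> tuples R (Suc (length t))" "f = loc_free W act t c"
    "Poly_Mapping.keys d \<subseteq> tuples R (Suc (length t))" "g = loc_free W act t d"
    using assms by (auto simp: loc_image_def)
  then have "Poly_Mapping.keys (c - d) \<subseteq> tuples R (Suc (length t))" using keys_diff[of c d] by blast
  then show ?thesis
    unfolding loc_image_def by (intro image_eqI[where x = "c - d"]) (simp_all add: loc_free_diff cd)
qed

lemma loc_image_uminus: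
  assumes "f \<in> loc_image t" shows "(\<lambda>\<epsilon>\<in>Sub t. - f \<epsilon>) \<in> loc_image t"
  by (rule loc_image_cong[OF loc_image_diff[OF loc_image_zero assms]]) simp

lemma loc_image_add:
  assumes "f \<in> loc_image t" "g \<in> loc_image t" shows "(\<lambda>\<epsilon>\<in>Sub t. f \<epsilon> + g \<epsilon>) \<in> loc_image t"
  by (rule loc_image_cong[OF loc_image_diff[OF assms(1) loc_image_uminus[OF assms(2)]]]) simp

lemma loc_image_extensional: "g \<in> loc_image t \<Longrightarrow> g \<in> extensional (Sub t)"
  by (auto simp: loc_image_def loc_free_def)

lemma tuples_nth: "xs \<in> tuples R k \<Longrightarrow> i < k \<Longrightarrow> xs ! i \<in> R"
  using nth_mem[of i xs] by (auto simp: tuples_def)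

text \<open>
  \<open>Loc\<close> is multiplicative: tuples multiply factorwise and the group acts by ring automorphisms.
\<close>

lemma loc_image_mult:
  assumes t: "set t \<subseteq> T" and "f \<in> loc_image t" and g: "g \<in> loc_image t"
  shows "(\<lambda>\<epsilon>\<in>Sub t. f \<epsilon> * g \<epsilon>) \<in> loc_image t"
  using assms(2)
proof (induction rule: loc_image_induct)
  case zero
  show ?case by (rule loc_image_cong[OF loc_image_zero]) simp
next
  case (pure xs)
  from g show ?case
  proof (induction rule: loc_image_induct)
    case zero
    show ?case by (rule loc_image_cong[OF loc_image_zero]) simp
  next
    case ys: (pure ys)
    let ?zs = "map2 (*) xs ys"
    have len: "length xs = Suc (length t)" "length ys = Suc (length t)"
      using pure ys by (auto simp: tuples_def)
    have zs: "?zs \<in> tuples R (Suc (length t))"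
      using pure ys by (auto simp: tuples_def intro!: R_mult dest: set_zip_leftD set_zip_rightD)
    have "loc_tuple W act t ?zs \<epsilon> = loc_tuple W act t xs \<epsilon> * loc_tuple W act t ys \<epsilon>" for \<epsilon>
      unfolding loc_tuple_def prod.distrib[symmetric] using len pure ys
      by (intro prod.cong) (simp_all add: act_mult prefix_closed[OF t] tuples_nth)
    then show ?case by (intro loc_image_cong[OF loc_image_pure[OF zs]]) simp
  next
    case (diff f g)
    show ?case by (rule loc_image_cong[OF loc_image_diff[OF diff]]) (simp add: right_diff_distrib)
  qed
next
  case (diff f g)
  show ?case by (rule loc_image_cong[OF loc_image_diff[OF diff]]) (simp add: left_diff_distrib)
qed

lemma loc_image_one:
  assumes "set t \<subseteq> T"
  shows "(\<lambda>\<epsilon>\<in>Sub t. 1) \<in> loc_image t"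
proof -
  let ?xs = "replicate (Suc (length t)) 1"
  have "loc_tuple W act t ?xs \<epsilon> = 1" for \<epsilon>
    unfolding loc_tuple_def using act_1 prefix_closed[OF assms]
    by (intro prod.neutral) (simp del: replicate_Suc)
  then show ?thesis
    using loc_image_pure[of ?xs t] by (simp add: tuples_def del: replicate_Suc)
qed

lemma loc_append_tuple:
  assumes "length xs = Suc (length t)"
  shows "loc_append t x a (\<lambda>\<epsilon>\<in>Sub t. loc_tuple W act t xs \<epsilon>)
    = (\<lambda>\<eta>\<in>Sub (t @ [x]). loc_tuple W act (t @ [x]) (xs @ [a]) \<eta>)"
proof
  fix \<eta>
  show "loc_append t x a (\<lambda>\<epsilon>\<in>Sub t. loc_tuple W act t xs \<epsilon>) \<eta>
    = (\<lambda>\<eta>\<in>Sub (t @ [x]). loc_tuple W act (t @ [x]) (xs @ [a]) \<eta>) \<eta>"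
  proof (cases "\<eta> \<in> Sub (t @ [x])")
    case True
    then obtain \<epsilon> b where \<epsilon>: "\<epsilon> \<in> Sub t" "\<eta> = \<epsilon> @ [b]" by (auto simp: Sub_snoc)
    have "loc_tuple W act (t @ [x]) (xs @ [a]) \<eta>
        = loc_tuple W act t xs \<epsilon> * act (prefix_prod W (t @ [x]) \<eta> (Suc (length t))) a"
      using assms \<epsilon> by (simp add: loc_tuple_def nth_append prefix_prod_snoc)
    then show ?thesis using True \<epsilon> loc_append_snoc[OF \<epsilon>(1)] by simp
  qed (simp add: loc_append_def)
qed

lemma loc_image_append:
  assumes "f \<in> loc_image t" "a \<in> R"
  shows "loc_append t x a f \<in> loc_image (t @ [x])"
  using assms(1)
proof (induction rule: loc_image_induct)
  case zero
  have "loc_append t x a (\<lambda>\<epsilon>\<in>Sub t. 0) = (\<lambda>\<eta>\<in>Sub (t @ [x]). 0)"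
    by (auto simp: loc_append_def fun_eq_iff Sub_snoc)
  then show ?case by (simp only: loc_image_zero)
next
  case (pure xs)
  then have "xs @ [a] \<in> tuples R (Suc (length (t @ [x])))" using assms(2) by (auto simp: tuples_def)
  moreover have "length xs = Suc (length t)" using pure by (simp add: tuples_def)
  ultimately show ?case by (simp only: loc_append_tuple loc_image_pure)
next
  case (diff f g)
  have "loc_append t x a (\<lambda>\<epsilon>\<in>Sub t. f \<epsilon> - g \<epsilon>)
      = (\<lambda>\<eta>\<in>Sub (t @ [x]). loc_append t x a f \<eta> - loc_append t x a g \<eta>)"
    by (auto simp: loc_append_def fun_eq_iff Sub_snoc left_diff_distrib)
  then show ?case using loc_image_diff[OF diff] by (simp only:)
qed

lemma loc_image_is_local: "set t \<subseteq> T \<Longrightarrow> g \<in> loc_image t \<Longrightarrow> is_local t g"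
proof (induction t arbitrary: g rule: rev_induct)
  case Nil
  from Nil(2) show ?case
  proof (induction rule: loc_image_induct)
    case (pure xs)
    then have "loc_tuple W act [] xs \<epsilon> \<in> R" for \<epsilon>
      using tuples_nth[of xs 1 0] by (simp add: loc_tuple_def prefix_prod_def list_prod_def)
    then show ?case by (auto simp: is_local_def positions_def)
  qed (simp_all only: is_local_restrict is_local_zero is_local_diff)
next
  case (snoc x t)
  then have t: "set t \<subseteq> T" "x \<in> T" by auto
  from snoc.prems(2) show ?case
  proof (induction rule: loc_image_induct)
    case (pure xs)
    then obtain ys a where xs: "xs = ys @ [a]" "a \<in> R" "ys \<in> tuples R (Suc (length t))"
      by (cases xs rule: rev_cases) (auto simp: tuples_def)
    have "is_local (t @ [x]) (loc_append t x a (\<lambda>\<epsilon>\<in>Sub t. loc_tuple W act t ys \<epsilon>))"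
      by (intro is_local_append t xs snoc.IH loc_image_pure)
    moreover have "length ys = Suc (length t)" using xs by (simp add: tuples_def)
    ultimately show ?case by (simp only: loc_append_tuple xs)
  qed (simp_all only: is_local_restrict is_local_zero is_local_diff)
qed

text \<open>
  Each decomposition step contributes one tensor factor, \<open>1\<close> or \<open>rt x\<close>; only the first factor is an
  arbitrary element of \<open>R\<close>.
\<close>

lemma is_local_loc_image:
  "set t \<subseteq> T \<Longrightarrow> is_local t g \<Longrightarrow> restrict g (Sub t) \<in> loc_image t"
proof (induction t arbitrary: g rule: rev_induct)
  case Nil
  have Sub: "Sub [] = {[]}" by (auto simp: Sub_def)
  have g: "g [] \<in> R" using is_localD(1)[OF Nil(2), of "[]"] by (simp add: Sub)
  then have "[g []] \<in> tuples R (Suc (length []))" by (simp add: tuples_def)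
  then show ?case
    using g by (intro loc_image_cong[OF loc_image_pure])
      (auto simp: Sub loc_tuple_def prefix_prod_def list_prod_def)
next
  case (snoc x t)
  then have t: "set t \<subseteq> T" "x \<in> T" by auto
  obtain h\<^sub>0 h\<^sub>1 where h: "is_local t h\<^sub>0" "is_local t h\<^sub>1"
    "\<And>\<eta>. \<eta> \<in> Sub (t @ [x]) \<Longrightarrow> g \<eta> = loc_append t x 1 h\<^sub>0 \<eta> + loc_append t x (rt x) h\<^sub>1 \<eta>"
    using is_local_snoc_decompose[OF t snoc.prems(2)] by blast
  have "loc_append t x a h = loc_append t x a (restrict h (Sub t))" for a h
    by (auto simp: loc_append_def fun_eq_iff Sub_snoc)
  then have "loc_append t x a h \<in> loc_image (t @ [x])" if "a \<in> R" "is_local t h" for a h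
    using loc_image_append[OF snoc.IH[OF t(1) that(2)] that(1)] by metis
  then have "(\<lambda>\<eta>\<in>Sub (t @ [x]). loc_append t x 1 h\<^sub>0 \<eta> + loc_append t x (rt x) h\<^sub>1 \<eta>)
      \<in> loc_image (t @ [x])"
    using h(1,2) t(2) by (intro loc_image_add) (auto intro: rt_R)
  then show ?case by (rule loc_image_cong) (simp add: h(3))
qed

theorem loc_image_eq_local_functions:
  assumes "set t \<subseteq> T"
  shows "loc_image t = local_functions W S R rt t"
proof (rule subset_antisym; rule subsetI)
  fix g assume "g \<in> loc_image t"
  then show "g \<in> local_functions W S R rt t"
    by (simp add: local_functions_iff loc_image_extensional loc_image_is_local[OF assms])
next
  fix g assume "g \<in> local_functions W S R rt t"
  then show "g \<in> loc_image t"
    using is_local_loc_image[OF assms, of g] by (simp add: local_functions_iff extensional_restrict)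
qed

lemma ring_fun_ring: "ring (fun_ring I R)"
proof (intro ringI abelian_groupI monoidI)
  fix f assume "f \<in> carrier (fun_ring I R)"
  then show "\<exists>g\<in>carrier (fun_ring I R). g \<oplus>\<^bsub>fun_ring I R\<^esub> f = \<zero>\<^bsub>fun_ring I R\<^esub>"
    by (intro bexI[of _ "\<lambda>i\<in>I. - f i"]) (auto simp: fun_ring_def fun_eq_iff intro: R_uminus)
qed (auto simp: fun_ring_def fun_eq_iff algebra_simps PiE_iff extensional_def intro: R_add R_mult)

lemma subring_local_functions:
  assumes t: "set t \<subseteq> T"
  shows "subring (local_functions W S R rt t) (fun_ring (Sub t) R)"
proof -
  interpret fr: ring "fun_ring (Sub t) R" by (rule ring_fun_ring)
  let ?L = "local_functions W S R rt t"
  have L: "?L = loc_image t" using loc_image_eq_local_functions[OF t] ..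
  show ?thesis
  proof (rule fr.subringI)
    show sub: "?L \<subseteq> carrier (fun_ring (Sub t) R)" by (auto simp: local_functions_def)
    show "\<one>\<^bsub>fun_ring (Sub t) R\<^esub> \<in> ?L"
      using loc_image_one[OF t] by (simp add: L fun_ring_def)
    show "\<ominus>\<^bsub>fun_ring (Sub t) R\<^esub> f \<in> ?L" if "f \<in> ?L" for f
    proof -
      have g: "(\<lambda>\<epsilon>\<in>Sub t. - f \<epsilon>) \<in> ?L" using loc_image_uminus that by (simp add: L)
      moreover have "\<ominus>\<^bsub>fun_ring (Sub t) R\<^esub> f = (\<lambda>\<epsilon>\<in>Sub t. - f \<epsilon>)"
        using subsetD[OF sub g] subsetD[OF sub that]
        by (intro fr.minus_equality) (auto simp: fun_ring_def fun_eq_iff)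
      ultimately show ?thesis by simp
    qed
    show "f \<otimes>\<^bsub>fun_ring (Sub t) R\<^esub> g \<in> ?L" if "f \<in> ?L" "g \<in> ?L" for f g
      using loc_image_mult[OF t] that by (simp add: L fun_ring_def)
    show "f \<oplus>\<^bsub>fun_ring (Sub t) R\<^esub> g \<in> ?L" if "f \<in> ?L" "g \<in> ?L" for f g
      using loc_image_add that by (simp add: L fun_ring_def)
  qed
qed

end

section \<open>Roots in the symmetric algebra\<close>

lemma mpoly_eval_ident: "mpoly_eval mconst mvar p = (p :: 'k::comm_ring_1 mpoly)"
  by (rule mpoly_hom_eqI[where G = "\<lambda>p. p"])
    (simp_all add: mconst.mpoly_eval_add mconst.mpoly_eval_mult)

lemma Sym_induct [consumes 1, case_names const var add mult]:
  fixes p :: "'k::comm_ring_1 mpoly"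
  assumes p: "p \<in> Sym n" and const: "\<And>c. P (mconst c)" and var: "\<And>i. i < n \<Longrightarrow> P (mvar i)"
    and add: "\<And>p q. P p \<Longrightarrow> P q \<Longrightarrow> P (p + q)"
    and mult: "\<And>p q. P p \<Longrightarrow> P q \<Longrightarrow> P (p * q)"
  shows "P p"
proof -
  have 0: "P 0" and 1: "P 1" using const[of 0] const[of 1] by simp_all
  have pow: "P (q ^ k)" if "P q" for q k
    using that by (induction k) (auto intro: 1 mult)
  have prod: "P (prod f A)" if "\<And>i. i \<in> A \<Longrightarrow> P (f i)" for f :: "nat \<Rightarrow> 'k mpoly" and A
    using that by (induction A rule: infinite_finite_induct) (auto intro: 1 mult)
  have sum: "P (sum f A)" if "\<And>i. i \<in> A \<Longrightarrow> P (f i)" for f :: "(nat \<Rightarrow>\<^sub>0 nat) \<Rightarrow> 'k mpoly" and A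
    using that by (induction A rule: infinite_finite_induct) (auto intro: 0 add)
  have "P (mpoly_eval mconst mvar p)"
    unfolding mpoly_eval_def mono_eval_def
    using p by (intro sum mult const prod pow var) (auto simp: Sym_def)
  then show ?thesis by (simp add: mpoly_eval_ident)
qed

lemma mconst_eq_0_iff [simp]: "mconst c = 0 \<longleftrightarrow> c = 0"
  unfolding mconst_def by (metis lookup_single_eq lookup_zero single_zero)

context basis_setting
begin

lemma sym_incl_diff: "sym_incl scale n e (u - v) = sym_incl scale n e u - sym_incl scale n e v"
  using sym_incl_add[of "u - v" v] by (simp add: algebra_simps)

lemma sym_incl_0 [simp]: "sym_incl scale n e 0 = 0"
  using sym_incl_scale[of 0 0] by simp

text \<open>
  The coordinates of \<open>v\<close> are the coefficients of its linear form.
\<close>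

lemma sym_incl_eq_0_iff: "sym_incl scale n e v = 0 \<longleftrightarrow> v = 0"
proof
  assume 0: "sym_incl scale n e v = 0"
  have "coord j v = 0" if j: "j < n" for j
  proof -
    have "Poly_Mapping.single i 1 = (Poly_Mapping.single j 1 :: nat \<Rightarrow>\<^sub>0 nat) \<longleftrightarrow> i = j" for i
    proof
      assume "Poly_Mapping.single i 1 = (Poly_Mapping.single j 1 :: nat \<Rightarrow>\<^sub>0 nat)"
      then have "Poly_Mapping.lookup (Poly_Mapping.single j (1::nat)) i = 1"
        by (metis lookup_single_eq)
      then show "i = j" by (simp add: lookup_single when_def split: if_splits)
    qed simp
    then have "Poly_Mapping.lookup (mconst c * mvar i) (Poly_Mapping.single j 1) = (if i = j then c else 0)"
      for c :: 'k and i
      by (simp add: mconst_def mvar_def mult_single lookup_single when_def)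
    then have "Poly_Mapping.lookup (sym_incl scale n e v) (Poly_Mapping.single j 1) = coord j v"
      using j by (simp add: sym_incl_def lookup_sum)
    then show ?thesis by (simp add: 0)
  qed
  then show "v = 0" using coord_expansion[of v] by simp
qed simp

text \<open>
  The elements on which \<open>f\<close> acts trivially modulo \<open>a\<close> form a subalgebra, and it contains the variables.
  This serves twice: for a reflection and its root, and for the projection along a root.
\<close>

lemma sym_map_diff_dvd:
  assumes "p \<in> Sym n" and f: "\<And>v. \<exists>c. v - f v = scale c a"
  shows "\<exists>q\<in>Sym n. p - sym_map scale n e f p = sym_incl scale n e a * q"
proof -
  have "p \<in> Sym n \<and> (\<exists>q\<in>Sym n. p - sym_map scale n e f p = sym_incl scale n e a * q)"
    using assms(1)
  proof (induction rule: Sym_induct)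
    case (const c)
    then show ?case by (auto intro: bexI[of _ 0])
  next
    case (var i)
    obtain c where c: "e i - f (e i) = scale c a" using f by blast
    have "mvar i - sym_map scale n e f (mvar i) = sym_incl scale n e (e i - f (e i))"
      using var by (simp add: sym_map_mvar sym_incl_diff sym_incl_e)
    also have "\<dots> = sym_incl scale n e a * mconst c"
      unfolding c by (simp add: sym_incl_scale mult.commute)
    finally have "mvar i - sym_map scale n e f (mvar i) = sym_incl scale n e a * mconst c" .
    then show ?case using var by (auto intro: bexI[of _ "mconst c"])
  next
    case (add p q)
    then obtain p' q' where "p' \<in> Sym n" "q' \<in> Sym n"
      "p - sym_map scale n e f p = sym_incl scale n e a * p'"
      "q - sym_map scale n e f q = sym_incl scale n e a * q'" by blast
    then show ?case using add
      by (intro conjI bexI[of _ "p' + q'"]) (auto simp: sym_map_add algebra_simps intro: Sym_add)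
  next
    case (mult p q)
    then obtain p' q' where pq: "p' \<in> Sym n" "q' \<in> Sym n"
      "p - sym_map scale n e f p = sym_incl scale n e a * p'"
      "q - sym_map scale n e f q = sym_incl scale n e a * q'" by blast
    have "p * q - sym_map scale n e f (p * q)
        = (p - sym_map scale n e f p) * q + sym_map scale n e f p * (q - sym_map scale n e f q)"
      by (simp add: sym_map_mult algebra_simps)
    also have "\<dots> = sym_incl scale n e a * (p' * q + sym_map scale n e f p * q')"
      by (simp add: pq algebra_simps)
    finally show ?case using mult pq(1,2)
      by (intro conjI bexI[of _ "p' * q + sym_map scale n e f p * q'"])
        (auto intro!: Sym_add Sym_mult sym_map_Sym)
  qed
  then show ?thesis by blast
qed

end

locale reflection_representation =
  basis_setting scale n e + faithful_action W UNIV \<rho>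
  for W :: "('w, 'b) monoid_scheme" (structure)
    and scale :: "'k::field \<Rightarrow> 'v::ab_group_add \<Rightarrow> 'v" and n :: nat and e :: "nat \<Rightarrow> 'v"
    and \<rho> :: "'w \<Rightarrow> 'v \<Rightarrow> 'v" +
  fixes S :: "'w set" and \<alpha> :: "'w \<Rightarrow> 'v" and \<alpha>\<^sub>v :: "'w \<Rightarrow> 'v \<Rightarrow> 'k" and \<sigma> :: "'k mpoly set"
  assumes generators: "S \<subseteq> carrier W"
    and two: "(2::'k) \<noteq> 0"
    and linear_action: "w \<in> carrier W \<Longrightarrow> Vector_Spaces.linear scale scale (\<rho> w)"
    and coroot_linear: "p \<in> reflections W S \<Longrightarrow> Vector_Spaces.linear scale (*) (\<alpha>\<^sub>v p)"
    and coroot_root: "p \<in> reflections W S \<Longrightarrow> \<alpha>\<^sub>v p (\<alpha> p) = 2"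
    and reflection: "p \<in> reflections W S \<Longrightarrow> \<rho> p v = v - scale (\<alpha>\<^sub>v p v) (\<alpha> p)"
    and GKM: "\<lbrakk>p \<in> reflections W S; q \<in> reflections W S; \<alpha> q = scale c (\<alpha> p)\<rbrakk> \<Longrightarrow> p = q"
    and \<sigma>_Sym: "\<sigma> \<subseteq> Sym n"
    and \<sigma>_one: "1 \<in> \<sigma>"
    and \<sigma>_mult: "\<forall>f\<in>\<sigma>. \<forall>g\<in>\<sigma>. f * g \<in> \<sigma>"
    and \<sigma>_invariant: "\<forall>w\<in>carrier W. \<forall>f\<in>\<sigma>. sym_map scale n e (\<rho> w) f \<in> \<sigma>"
    and \<sigma>_roots: "\<lbrakk>f \<in> \<sigma>; p \<in> reflections W S; g \<in> Sym n\<rbrakk> \<Longrightarrow> f \<noteq> sym_incl scale n e (\<alpha> p) * g"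
begin

abbreviation "T \<equiv> reflections W S"
abbreviation "\<iota> \<equiv> sym_incl scale n e"
abbreviation "wact w \<equiv> sym_map scale n e (\<rho> w)"
abbreviation "R \<equiv> localization (Sym n) \<sigma>"
abbreviation "act \<equiv> \<lambda>w. fract_map (sym_map scale n e (\<rho> w))"
abbreviation "rt \<equiv> \<lambda>p. Fraction_Field.Fract (sym_incl scale n e (\<alpha> p)) 1"

sublocale W: group W
  using group_hom by (simp add: group_hom_def)

lemma ring_action: "ring_action W R act"
  using basis faithful_action_axioms linear_action \<sigma>_Sym \<sigma>_one \<sigma>_mult \<sigma>_invariant
  by (intro ring_action_localization) auto

lemma \<rho>_one: "\<rho> \<one> = (\<lambda>v. v)"
  using id_eq_one by (simp add: restrict_def)

lemma \<rho>_mult: "u \<in> carrier W \<Longrightarrow> w \<in> carrier W \<Longrightarrow> \<rho> (u \<otimes> w) v = \<rho> u (\<rho> w v)"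
  using composition_rule[of v u w] by simp

lemma reflection_carrier: "p \<in> T \<Longrightarrow> p \<in> carrier W"
  using W.reflections_carrier[OF generators] .

lemma coroot_diff: "p \<in> T \<Longrightarrow> \<alpha>\<^sub>v p (u - v) = \<alpha>\<^sub>v p u - \<alpha>\<^sub>v p v"
  and coroot_add: "p \<in> T \<Longrightarrow> \<alpha>\<^sub>v p (u + v) = \<alpha>\<^sub>v p u + \<alpha>\<^sub>v p v"
  and coroot_scale: "p \<in> T \<Longrightarrow> \<alpha>\<^sub>v p (scale c v) = c * \<alpha>\<^sub>v p v"
  and coroot_0: "p \<in> T \<Longrightarrow> \<alpha>\<^sub>v p 0 = 0"
proof -
  assume "p \<in> T"
  then interpret Vector_Spaces.linear scale "(*)" "\<alpha>\<^sub>v p" by (rule coroot_linear)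
  show "\<alpha>\<^sub>v p (u - v) = \<alpha>\<^sub>v p u - \<alpha>\<^sub>v p v" "\<alpha>\<^sub>v p (u + v) = \<alpha>\<^sub>v p u + \<alpha>\<^sub>v p v"
    "\<alpha>\<^sub>v p (scale c v) = c * \<alpha>\<^sub>v p v" "\<alpha>\<^sub>v p 0 = 0"
    by (simp_all add: diff add scale)
qed

lemma root_nonzero: "p \<in> T \<Longrightarrow> \<alpha> p \<noteq> 0"
  using coroot_root[of p] coroot_0[of p] two by auto

lemma reflection_involutive:
  assumes "p \<in> T" shows "p \<otimes> p = \<one>"
proof -
  have p: "p \<in> carrier W" using reflection_carrier assms .
  have "\<rho> (p \<otimes> p) v = v" for v
  proof -
    have "\<alpha>\<^sub>v p (\<rho> p v) = - \<alpha>\<^sub>v p v"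
      using assms by (simp add: reflection coroot_diff coroot_scale coroot_root)
    then have "\<rho> p (\<rho> p v) = \<rho> p v - scale (- \<alpha>\<^sub>v p v) (\<alpha> p)"
      using assms by (simp add: reflection[of p "\<rho> p v"])
    then show ?thesis using assms p by (simp add: \<rho>_mult reflection[of p v])
  qed
  then have "\<rho> (p \<otimes> p) = \<rho> \<one>" by (simp add: \<rho>_one fun_eq_iff)
  then show ?thesis using faithful p by (auto dest: inj_onD)
qed

text \<open>
  The reflection \<open>w p w\<^sup>-\<^sup>1\<close> negates \<open>\<rho> w (\<alpha> p)\<close>, and a reflection negates only multiples of its own root
  because \<open>2\<close> is invertible.
\<close>

lemma root_conj:
  assumes w: "w \<in> carrier W" and p: "p \<in> T"
  obtains c where "c \<noteq> 0" "\<rho> w (\<alpha> p) = scale c (\<alpha> (w \<otimes> p \<otimes> inv w))"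
proof
  let ?q = "w \<otimes> p \<otimes> inv w" and ?v = "\<rho> w (\<alpha> p)"
  interpret w: Vector_Spaces.linear scale scale "\<rho> w" by (rule linear_action[OF w])
  have pW: "p \<in> carrier W" using reflection_carrier p .
  have inv: "\<rho> (inv w) (\<rho> w v) = v" for v using w \<rho>_mult[of "inv w" w v] by (simp add: \<rho>_one)
  have "\<rho> ?q ?v = \<rho> w (\<rho> p (\<alpha> p))"
    using w pW by (simp add: \<rho>_mult inv)
  also have "\<rho> p (\<alpha> p) = - \<alpha> p"
    using p fin.scale_left_distrib[of 1 1 "\<alpha> p"] by (simp add: reflection coroot_root)
  finally have "?v - scale (\<alpha>\<^sub>v ?q ?v) (\<alpha> ?q) = - ?v"
    using W.reflections_conj[OF generators w p] by (simp add: reflection w.neg)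
  then have "scale 2 ?v = scale (\<alpha>\<^sub>v ?q ?v) (\<alpha> ?q)"
    using fin.scale_left_distrib[of 1 1 ?v] by (simp add: algebra_simps)
  then have "scale (inverse 2) (scale 2 ?v) = scale (inverse 2) (scale (\<alpha>\<^sub>v ?q ?v) (\<alpha> ?q))" by simp
  then show eq: "?v = scale (inverse 2 * \<alpha>\<^sub>v ?q ?v) (\<alpha> ?q)" using two by simp
  have "?v \<noteq> 0" using inv[of "\<alpha> p"] inv[of 0] w.zero root_nonzero[OF p] by metis
  then show "inverse 2 * \<alpha>\<^sub>v ?q ?v \<noteq> 0" using eq by (metis fin.scale_zero_left)
qed

lemma wact_eq_0_iff:
  assumes "w \<in> carrier W" shows "wact w f = 0 \<longleftrightarrow> f = 0"
proof
  assume "wact w f = 0"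
  then have "wact (inv w) (wact w f) = 0" by simp
  moreover have "\<rho> (inv w) \<circ> \<rho> w = (\<lambda>v. v)"
    using assms \<rho>_mult[of "inv w" w] by (auto simp: \<rho>_one fun_eq_iff)
  ultimately show "f = 0"
    using assms by (simp add: sym_map_compose linear_action sym_map_id)
qed simp

lemma act_Fract:
  "w \<in> carrier W \<Longrightarrow> act w (Fraction_Field.Fract a b) = Fraction_Field.Fract (wact w a) (wact w b)"
  by (rule fract_map_Fract) (simp_all add: sym_map_mult wact_eq_0_iff)

text \<open>
  The denominator is nonzero because \<open>0\<close> is divisible by the root of \<open>p\<close>; this is why the existence
  of a reflection \<open>p\<close> is required.
\<close>

lemma localizationE:
  assumes "x \<in> R" "p \<in> T"
  obtains a s where "x = Fraction_Field.Fract a s" "a \<in> Sym n" "s \<in> \<sigma>" "s \<noteq> 0"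
  using assms \<sigma>_roots[of 0 p 0] by (auto simp: localization_def)

lemma localizationI: "a \<in> Sym n \<Longrightarrow> s \<in> \<sigma> \<Longrightarrow> Fraction_Field.Fract a s \<in> R"
  by (auto simp: localization_def)

text \<open>
  The map \<open>\<pi> = (1 + p) / 2\<close> is the projection along the root of \<open>p\<close>.  Divisibility by that root becomes
  membership in the kernel of a homomorphism into a domain, so the root is prime.
\<close>

lemma root_dvd_iff:
  assumes p: "p \<in> T" and f: "f \<in> Sym n"
  defines "\<pi> \<equiv> \<lambda>v. v - scale (inverse 2 * \<alpha>\<^sub>v p v) (\<alpha> p)"
  shows "(\<exists>g\<in>Sym n. f = \<iota> (\<alpha> p) * g) \<longleftrightarrow> sym_map scale n e \<pi> f = 0"
    and "sym_map scale n e \<pi> (\<iota> v) = \<iota> (\<pi> v)"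
proof -
  have lin: "Vector_Spaces.linear scale scale \<pi>"
    unfolding \<pi>_def using p
    by unfold_locales (simp_all add: coroot_add coroot_scale algebra_simps
        fin.scale_left_distrib fin.scale_right_distrib fin.scale_right_diff_distrib)
  show incl: "sym_map scale n e \<pi> (\<iota> v) = \<iota> (\<pi> v)" for v by (rule sym_map_incl[OF lin])
  have "\<pi> (\<alpha> p) = 0" using p two by (simp add: \<pi>_def coroot_root)
  then have root: "sym_map scale n e \<pi> (\<iota> (\<alpha> p)) = 0" by (simp add: incl)
  have "\<exists>c. v - \<pi> v = scale c (\<alpha> p)" for v
    by (rule exI[of _ "inverse 2 * \<alpha>\<^sub>v p v"]) (simp add: \<pi>_def)
  then have "\<exists>g\<in>Sym n. f - sym_map scale n e \<pi> f = \<iota> (\<alpha> p) * g"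
    by (rule sym_map_diff_dvd[OF f])
  then show "(\<exists>g\<in>Sym n. f = \<iota> (\<alpha> p) * g) \<longleftrightarrow> sym_map scale n e \<pi> f = 0"
    by (auto simp: sym_map_mult root)
qed

text \<open>
  With \<open>f\<close> the reduction modulo the root of \<open>p\<close>, clearing denominators gives
  \<open>f (\<alpha> q) * f a * f r = 0\<close> for the numerator \<open>a\<close> of \<open>x\<close> and a denominator \<open>r\<close>.  Only \<open>f a\<close> can vanish:
  \<open>f r = 0\<close> would make a denominator divisible by a root, and \<open>f (\<alpha> q) = 0\<close> would make two roots
  proportional.
\<close>

lemma root_coprime:
  assumes p: "p \<in> T" and q: "q \<in> T" and "p \<noteq> q" and "x \<in> R" "y \<in> R" and eq: "rt q * x = rt p * y"
  shows "\<exists>z\<in>R. x = rt p * z"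
proof -
  obtain a s where x: "x = Fraction_Field.Fract a s" "a \<in> Sym n" "s \<in> \<sigma>" "s \<noteq> 0"
    using localizationE[OF \<open>x \<in> R\<close> p] .
  obtain b r where y: "y = Fraction_Field.Fract b r" "b \<in> Sym n" "r \<in> \<sigma>" "r \<noteq> 0"
    using localizationE[OF \<open>y \<in> R\<close> p] .
  define \<pi> where "\<pi> = (\<lambda>v. v - scale (inverse 2 * \<alpha>\<^sub>v p v) (\<alpha> p))"
  define f where "f = sym_map scale n e \<pi>"
  note dvd = root_dvd_iff[OF p, folded \<pi>_def, folded f_def]
  have "\<iota> (\<alpha> q) * a * r = \<iota> (\<alpha> p) * b * s"
    using eq x y by (simp add: eq_fract mult_ac)
  then have "f (\<iota> (\<alpha> q) * a * r) = f (\<iota> (\<alpha> p) * b * s)" by simp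
  moreover have "f (\<iota> (\<alpha> p)) = 0"
    using dvd(1)[OF sym_incl_Sym[of "\<alpha> p"]] by (auto intro: bexI[of _ 1])
  ultimately have "f (\<iota> (\<alpha> q)) * f a * f r = 0"
    by (simp add: f_def sym_map_mult)
  moreover have "f r \<noteq> 0" using dvd(1)[of r] \<sigma>_roots[OF y(3) p] \<sigma>_Sym y(3) by blast
  moreover have "f (\<iota> (\<alpha> q)) \<noteq> 0"
  proof
    assume "f (\<iota> (\<alpha> q)) = 0"
    then have "\<alpha> q = scale (inverse 2 * \<alpha>\<^sub>v p (\<alpha> q)) (\<alpha> p)"
      by (simp add: dvd(2)[OF Sym_0] sym_incl_eq_0_iff)
    then show False using GKM[OF p q] \<open>p \<noteq> q\<close> by blast
  qed
  ultimately have "f a = 0" by simp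
  then obtain a' where a': "a' \<in> Sym n" "a = \<iota> (\<alpha> p) * a'" using dvd(1)[OF x(2)] by blast
  then have "x = rt p * Fraction_Field.Fract a' s" by (simp add: x(1))
  then show ?thesis using localizationI[OF a'(1) x(3)] by blast
qed

text \<open>
  The polynomial case \<open>sym_map_diff_dvd\<close> passes to fractions \<open>a / s\<close> by the quotient rule; the new
  denominator \<open>s \<cdot> p s\<close> stays in \<open>\<sigma>\<close> as \<open>\<sigma>\<close> is invariant and multiplicative.
\<close>

lemma root_reflection_diff:
  assumes p: "p \<in> T" and "x \<in> R"
  shows "\<exists>y\<in>R. x - act p x = rt p * y"
proof -
  have pW: "p \<in> carrier W" using reflection_carrier p .
  obtain a s where x: "x = Fraction_Field.Fract a s" "a \<in> Sym n" "s \<in> \<sigma>" "s \<noteq> 0"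
    using localizationE[OF \<open>x \<in> R\<close> p] .
  have s': "wact p s \<in> \<sigma>" "wact p s \<noteq> 0" using x \<sigma>_invariant pW by (auto simp: wact_eq_0_iff)
  have "\<exists>c. v - \<rho> p v = scale c (\<alpha> p)" for v using p by (auto simp: reflection)
  note dvd = sym_map_diff_dvd[OF _ this]
  obtain a' s' where d: "a' \<in> Sym n" "a - wact p a = \<iota> (\<alpha> p) * a'"
    "s' \<in> Sym n" "s - wact p s = \<iota> (\<alpha> p) * s'"
    using dvd[OF x(2)] dvd[of s] x(3) \<sigma>_Sym by blast
  have "a * wact p s - wact p a * s = (a - wact p a) * wact p s - wact p a * (s - wact p s)"
    by (simp add: algebra_simps)
  also have "\<dots> = \<iota> (\<alpha> p) * (a' * wact p s - wact p a * s')" by (simp add: d algebra_simps)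
  finally have "x - act p x
      = rt p * Fraction_Field.Fract (a' * wact p s - wact p a * s') (s * wact p s)"
    using x s' pW by (simp add: act_Fract)
  moreover have "a' * wact p s + - (wact p a * s') \<in> Sym n"
    using x d s' \<sigma>_Sym by (intro Sym_add Sym_uminus Sym_mult sym_map_Sym) auto
  then have "Fraction_Field.Fract (a' * wact p s - wact p a * s') (s * wact p s) \<in> R"
    using x(3) s' \<sigma>_mult by (intro localizationI) auto
  ultimately show ?thesis by blast
qed

lemma two_mconst: "(2 :: 'k mpoly) = mconst 2"
  using mconst.h_add[of "1::'k" 1] by simp

sublocale roots: root_ring_action W R act S rt
proof (intro root_ring_action.intro ring_action root_ring_action_axioms.intro)
  have "Fraction_Field.Fract (2 :: 'k mpoly) 1 = 1 + 1" unfolding One_fract_def by simp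
  then have two_Fract: "(2 :: 'k mpoly fract) = Fraction_Field.Fract (mconst 2) 1"
    by (simp add: two_mconst)
  show "(2 :: 'k mpoly fract) \<noteq> 0"
    using two by (simp add: two_Fract Zero_fract_def eq_fract)
  have "mconst (inverse 2) * mconst 2 = (1 :: 'k mpoly)"
    using two by (simp flip: mconst.h_mult)
  then have "inverse (2 :: 'k mpoly fract) = Fraction_Field.Fract (mconst (inverse 2)) 1"
    using two by (simp add: two_Fract eq_fract)
  then show "inverse 2 \<in> R" using localizationI[OF Sym_mconst \<sigma>_one] by (simp only:)
next
  fix w p assume w: "w \<in> carrier W" and p: "p \<in> T"
  obtain c where c: "c \<noteq> 0" "\<rho> w (\<alpha> p) = scale c (\<alpha> (w \<otimes> p \<otimes> inv w))"
    using root_conj[OF w p] .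
  have "mconst (inverse c) * mconst c = (1 :: 'k mpoly)" using c(1) by (simp flip: mconst.h_mult)
  then have inv: "inverse (Fraction_Field.Fract (mconst c) 1) = Fraction_Field.Fract (mconst (inverse c)) 1"
    using c(1) by (simp add: eq_fract)
  have "act w (rt p) = Fraction_Field.Fract (mconst c) 1 * rt (w \<otimes> p \<otimes> inv w)"
    using w by (simp add: act_Fract sym_map_incl linear_action c(2) sym_incl_scale)
  then show "\<exists>c. c \<in> R \<and> inverse c \<in> R \<and> c \<noteq> 0 \<and> act w (rt p) = c * rt (w \<otimes> p \<otimes> inv w)"
  proof (intro exI[of _ "Fraction_Field.Fract (mconst c) 1"] conjI)
    show "inverse (Fraction_Field.Fract (mconst c) 1) \<in> R"
      unfolding inv by (intro localizationI Sym_mconst \<sigma>_one)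
    show "Fraction_Field.Fract (mconst c) 1 \<noteq> 0" using c(1) by (simp add: Zero_fract_def eq_fract)
  qed (intro localizationI Sym_mconst \<sigma>_one)
next
  fix p assume p: "p \<in> T"
  have "\<rho> p (\<alpha> p) = - \<alpha> p"
    using p fin.scale_left_distrib[of 1 1 "\<alpha> p"] by (simp add: reflection coroot_root)
  then have "act p (rt p) = Fraction_Field.Fract (\<iota> (- \<alpha> p)) 1"
    using reflection_carrier[OF p] by (simp add: act_Fract sym_map_incl linear_action)
  then show "act p (rt p) = - rt p" using sym_incl_diff[of 0 "\<alpha> p"] by simp
  show "rt p \<in> R" by (intro localizationI sym_incl_Sym \<sigma>_one)
  show "rt p \<noteq> 0" using root_nonzero[OF p] by (simp add: Zero_fract_def eq_fract sym_incl_eq_0_iff)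
qed (fact generators reflection_involutive root_reflection_diff root_coprime)+

end

section \<open>The image of localization\<close>

theorem corollary3p11p2:
  fixes W :: "('w, 'b) monoid_scheme" and S :: "'w set"
    and scale :: "'k::field \<Rightarrow> 'v::ab_group_add \<Rightarrow> 'v"
    and n :: nat and e :: "nat \<Rightarrow> 'v"
    and \<rho> :: "'w \<Rightarrow> 'v \<Rightarrow> 'v"
    and \<alpha> :: "'w \<Rightarrow> 'v" and \<alpha>\<^sub>v :: "'w \<Rightarrow> 'v \<Rightarrow> 'k"
    and \<sigma> :: "'k mpoly set"
    and t :: "'w list"
  defines "T \<equiv> reflections W S"
    and "\<iota> \<equiv> sym_incl scale n e"
    and "wact \<equiv> \<lambda>w. sym_map scale n e (\<rho> w)"
    and "R \<equiv> localization (Sym n) \<sigma>"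
    and "act \<equiv> \<lambda>w. fract_map (sym_map scale n e (\<rho> w))"
    and "rt \<equiv> \<lambda>p. Fraction_Field.Fract (sym_incl scale n e (\<alpha> p)) 1"
  assumes coxeter: "coxeter_system W S"
    and char: "CHAR('k) \<noteq> 2"
    and basis: "basis_family scale n e"
    and linear_action: "\<forall>w\<in>carrier W. Vector_Spaces.linear scale scale (\<rho> w)"
    and faithful: "faithful_action W UNIV \<rho>"
    and coroot_linear: "\<forall>p\<in>T. Vector_Spaces.linear scale (*) (\<alpha>\<^sub>v p)"
    and coroot_root: "\<forall>p\<in>T. \<alpha>\<^sub>v p (\<alpha> p) = 2"
    and reflection: "\<forall>p\<in>T. \<forall>v. \<rho> p v = v - scale (\<alpha>\<^sub>v p v) (\<alpha> p)"
    and GKM: "\<forall>p\<in>T. \<forall>q\<in>T. (\<exists>c. \<alpha> q = scale c (\<alpha> p)) \<longrightarrow> p = q"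
    and \<sigma>_homogeneous: "\<sigma> \<subseteq> {f \<in> Sym n. homogeneous f}"
    and \<sigma>_one: "1 \<in> \<sigma>"
    and \<sigma>_mult: "\<forall>f\<in>\<sigma>. \<forall>g\<in>\<sigma>. f * g \<in> \<sigma>"
    and \<sigma>_invariant: "\<forall>w\<in>carrier W. \<forall>f\<in>\<sigma>. wact w f \<in> \<sigma>"
    and \<sigma>_roots: "\<forall>f\<in>\<sigma>. \<forall>p\<in>T. \<not> (\<exists>g\<in>Sym n. f = \<iota> (\<alpha> p) * g)"
    and expression: "set t \<subseteq> T"
  shows "Loc W act t ` carrier (expr_ring R act t) = local_functions W S R rt t
    \<and> subring (local_functions W S R rt t) (fun_ring (Sub t) R)"
proof -
  interpret basis_setting scale n e by unfold_locales (rule basis)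
  interpret faithful_action W UNIV \<rho> by (rule faithful)
  have two: "(2::'k) \<noteq> 0"
  proof
    assume "(2::'k) = 0"
    then have "CHAR('k) dvd 2" using of_nat_eq_0_iff_char_dvd[of 2, where 'a = 'k] by simp
    then have "CHAR('k) \<le> 2" "CHAR('k) \<noteq> 0" by (auto dest: dvd_imp_le intro!: Nat.gr0I)
    moreover have "CHAR('k) \<noteq> 1" by simp
    ultimately show False using char by linarith
  qed
  have sigma: "f \<noteq> sym_incl scale n e (\<alpha> p) * g"
    if "f \<in> \<sigma>" "p \<in> reflections W S" "g \<in> Sym n" for f p g
    using \<sigma>_roots that unfolding T_def \<iota>_def by blast
  interpret reflection_representation W scale n e \<rho> S \<alpha> \<alpha>\<^sub>v \<sigma>
  proof (intro reflection_representation.intro reflection_representation_axioms.intro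
      basis_setting_axioms faithful_action_axioms)
    show "S \<subseteq> carrier W" using coxeter by (simp add: coxeter_system_def)
    show "\<sigma> \<subseteq> Sym n" using \<sigma>_homogeneous by blast
    show "\<forall>w\<in>carrier W. \<forall>f\<in>\<sigma>. sym_map scale n e (\<rho> w) f \<in> \<sigma>"
      using \<sigma>_invariant by (simp add: wact_def)
    show "p = q" if "p \<in> reflections W S" "q \<in> reflections W S" "\<alpha> q = scale c (\<alpha> p)" for p q c
      using GKM that by (auto simp: T_def)
  qed (use two linear_action coroot_linear coroot_root reflection \<sigma>_one \<sigma>_mult sigma T_def in auto)
  show ?thesis
    using roots.Loc_image roots.loc_image_eq_local_functions roots.subring_local_functions expression
    unfolding T_def R_def act_def rt_def by simp
qed

end
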